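(* In IITT, if $\Delta\vdash t:T$ and $\Delta\vdash t':T$, then the algorithmic equality query $\Delta\vdash t\Longleftrightarrow_{\mathsf{tm}}t':T$ terminates (with success or failure).
   Context: Irrelevant Intensional Type Theory (IITT) is defined as follows. Sorts are $\mathsf{Set}_k$ ($k\in\mathbb{N}$), with $\mathsf{Axiom}=\{(\mathsf{Set}_i,\mathsf{Set}_{i+1})\}$ and $\mathsf{Rule}=\{(\mathsf{Set}_i,\mathsf{Set}_j,\mathsf{Set}_{\max(i,j)})\}$. Annotations $\star\in\{:,\div\}$ (relevant, irrelevant). Expressions: $t,u,T,U ::= s \mid (x\star U)\to^{s,s'}T \mid x \mid \lambda x\star U.\,t \mid t\star u$ (relevant/irrelevant dependent function types annotated with domain sort $s$ and codomain sort $s'$; abstractions; relevant application $t\,u$ and irrelevant application $t\div u$), modulo $\alpha$-equivalence; $[u/x]t$ is substitution. Contexts $\Gamma ::= ()\mid\Gamma.x\star T$. Resurrection $\Gamma^\oplus$ turns every $x\div T$ into $x:T$. Abbreviations: $\Gamma\vdash t\div T$ means $\Gamma^\oplus\vdash t:T$; $\Gamma\vdash t=t'\div T$ means $\Gamma\vdash t\div T$ and $\Gamma\vdash t'\div T$; $\Gamma\vdash T$ means $\Gamma\vdash T:s$ for some sort $s$; $\Gamma\vdash T=T'$ means $\Gamma\vdash T=T':s$ for some $s$. Rules: $\vdash()$; from $\vdash\Gamma$, $\Gamma\vdash T$ infer $\vdash\Gamma.x\star T$; from $\vdash\Gamma$, $(s,s')\in\mathsf{Axiom}$ infer $\Gamma\vdash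 s:s'$; from $\Gamma\vdash U:s_1$, $\Gamma.x\star U\vdash T:s_2$, $(s_1,s_2,s_3)\in\mathsf{Rule}$ infer $\Gamma\vdash(x\star U)\to^{s_1,s_2}T:s_3$; from $\vdash\Gamma$, $(x:U)\in\Gamma$ infer $\Gamma\vdash x:U$; from $\Gamma.x\star U\vdash t:T$, $\Gamma\vdash(x\star U)\to^{s,s'}T$ infer $\Gamma\vdash\lambda x\star U.t:(x\star U)\to^{s,s'}T$; from $\Gamma\vdash t:(x\star U)\to^{s,s'}T$, $\Gamma\vdash u\star U$ infer $\Gamma\vdash t\star u:[u/x]T$; from $\Gamma\vdash t:T$, $\Gamma\vdash T=T'$ infer $\Gamma\vdash t:T'$; $\beta$: from $\Gamma.x\star U\vdash t:T$, $\Gamma\vdash u\star U$ infer $\Gamma\vdash(\lambda x\star U.t)\star u=[u/x]t:[u/x]T$; $\eta$: from $\Gamma\vdash t:(x\star U)\to^{s,s'}T$ infer $\Gamma\vdash t=\lambda x\star U.(t\star x):(x\star U)\to^{s,s'}T$; reflexivity, symmetry, transitivity; congruence for function types (from $\Gamma\vdash U=U':s_1$, $\Gamma.x\star U\vdash T=T':s_2$, $(s_1,s_2,s_3)\in\mathsf{Rule}$), for abstractions (from $\Gamma\vdash U=U':s_1$, $\Gamma.x\star U\vdash T:s_2$, $\Gamma.x\star U\vdash t=t':T$ infer $\Gamma\vdash\lambda x\star U.t=\lambda x\star U'.t':(x\star U)\to^{s_1,s_2}T$), for application (from $\Gamma\vdash t=t':(x\star U)\to^{s,s'}T$ and $\Gamma\vdash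 u=u'\star U$ infer $\Gamma\vdash t\star u=t'\star u':[u/x]T$); conversion: from $\Gamma\vdash t=t':T$, $\Gamma\vdash T=T'$ infer $\Gamma\vdash t=t':T'$. Weak head normal forms $a,A ::= s\mid(x\star U)\to^{s,s'}T\mid\lambda x\star U.t\mid n$; neutrals $n,N ::= x\mid n\star u$. Weak head evaluation (computed deterministically, possibly diverging): $a\searrow a$ for whnf $a$; if $t\searrow f$ and $f\,@^\star u\searrow a$ then $t\star u\searrow a$; if $[u/x]t\searrow a$ then $(\lambda x\star U.t)\,@^\star u\searrow a$; $n\,@^\star u\searrow n\star u$. Algorithmic equality is the following syntax-directed recursive procedure (a query succeeds iff the corresponding judgement is derivable by the rules listed; in structural equality the type is an output). Type equality $\Delta\vdash T\Longleftrightarrow_{\mathsf{ty}}T'$: compute $T\searrow A$, $T'\searrow A'$, then query $\Delta\vdash A\longleftrightarrow_{\mathsf{ty}}A'$. $\Delta\vdash A\longleftrightarrow_{\mathsf{ty}}A'$: succeed if $A\equiv A'\equiv s$ a sort; if $A=(x\star U)\to^{s,s'}T$ and $A'=(x\star U')\to^{s,s'}T'$ (same $\star$, same sort annotations), query $\Delta\vdash U\Longleftrightarrow_{\mathsf{ty}}U'$ and then $\Delta.x\star U\vdash T\Longleftrightarrow_{\mathsf{ty}}T'$; if both are neutral $N,N'$, query $\Delta\vdash N\Longleftrightarrow_{\mathsf{ne}}N':?$; otherwise fail. Structural equality $\Delta\vdash n\Longleftrightarrow_{\mathsf{ne}}n':?$: if $n\equiv n'\equiv x$ with $(x:T)\in\Delta$,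 return $T$; if $n=m\,u$, $n'=m'\,u'$, query $\Delta\vdash m\longleftrightarrow_{\mathsf{ne}}m':?$, which must return $(x:U)\to^{s,s'}T$, then query $\Delta\vdash u\Longleftrightarrow_{\mathsf{tm}}u':U$ and return $[u/x]T$; if $n=m\div u$, $n'=m'\div u'$, query $\Delta\vdash m\longleftrightarrow_{\mathsf{ne}}m':?$, which must return $(x\div U)\to^{s,s'}T$, and return $[u/x]T$ (arguments not compared); otherwise fail. $\Delta\vdash n\longleftrightarrow_{\mathsf{ne}}n':?$: query $\Delta\vdash n\Longleftrightarrow_{\mathsf{ne}}n':?$ obtaining $T$, compute $T\searrow A$ and return $A$. Type-directed equality $\Delta\vdash t\Longleftrightarrow_{\mathsf{tm}}t':T$: compute $T\searrow A$ and query $\Delta\vdash t\longleftrightarrow_{\mathsf{tm}}t':A$; $\Delta\vdash t\longleftrightarrow_{\mathsf{tm}}t':A$: if $A=(x\star U)\to^{s,s'}T$, query $\Delta.x\star U\vdash t\star x\Longleftrightarrow_{\mathsf{tm}}t'\star x:T$; if $A$ is a sort, query $\Delta\vdash t\Longleftrightarrow_{\mathsf{ty}}t'$; if $A$ is neutral, compute $t\searrow n$, $t'\searrow n'$ and query $\Delta\vdash n\Longleftrightarrow_{\mathsf{ne}}n':?$ (succeeding if it succeeds, whatever type is returned); otherwise fail. A query terminates if this procedure halts. *)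

theory Defs
  imports Main
begin

section \<open>Syntax\<close>

datatype sort = Set nat

definition Axiom :: "(sort \<times> sort) set" where
  "Axiom = {(Set i, Set (Suc i)) | i. True}"

definition Rule :: "(sort \<times> sort \<times> sort) set" where
  "Rule = {(Set i, Set j, Set (max i j)) | i j. True}"

datatype ann = Rel | Irr

text \<open>Expressions modulo \<open>\<alpha>\<close>-equivalence, as de Bruijn terms.
  \<open>Pi r s s' U T\<close> is the function type with annotation \<open>r\<close>, domain \<open>U\<close> of sort \<open>s\<close> and
  codomain \<open>T\<close> of sort \<open>s'\<close>; it binds index 0 in \<open>T\<close>.
  \<open>Lam r U t\<close> binds index 0 in \<open>t\<close>.\<close>

datatype tm =
    Sort sort
  | Pi ann sort sort tm tm
  | Var nat
  | Lam ann tm tm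
  | App ann tm tm

definition up_ren :: "(nat \<Rightarrow> nat) \<Rightarrow> nat \<Rightarrow> nat" where
  "up_ren \<rho> = (\<lambda>i. case i of 0 \<Rightarrow> 0 | Suc j \<Rightarrow> Suc (\<rho> j))"

primrec ren :: "(nat \<Rightarrow> nat) \<Rightarrow> tm \<Rightarrow> tm" where
  "ren \<rho> (Sort s) = Sort s"
| "ren \<rho> (Pi r s s' U T) = Pi r s s' (ren \<rho> U) (ren (up_ren \<rho>) T)"
| "ren \<rho> (Var i) = Var (\<rho> i)"
| "ren \<rho> (Lam r U t) = Lam r (ren \<rho> U) (ren (up_ren \<rho>) t)"
| "ren \<rho> (App r t u) = App r (ren \<rho> t) (ren \<rho> u)"

definition up_sub :: "(nat \<Rightarrow> tm) \<Rightarrow> nat \<Rightarrow> tm" where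
  "up_sub \<sigma> = (\<lambda>i. case i of 0 \<Rightarrow> Var 0 | Suc j \<Rightarrow> ren Suc (\<sigma> j))"

primrec sub :: "(nat \<Rightarrow> tm) \<Rightarrow> tm \<Rightarrow> tm" where
  "sub \<sigma> (Sort s) = Sort s"
| "sub \<sigma> (Pi r s s' U T) = Pi r s s' (sub \<sigma> U) (sub (up_sub \<sigma>) T)"
| "sub \<sigma> (Var i) = \<sigma> i"
| "sub \<sigma> (Lam r U t) = Lam r (sub \<sigma> U) (sub (up_sub \<sigma>) t)"
| "sub \<sigma> (App r t u) = App r (sub \<sigma> t) (sub \<sigma> u)"

text \<open>\<open>inst u t\<close> is \<open>[u/x]t\<close> for the variable \<open>x\<close> with index 0, which is removed from the scope.\<close>

definition inst :: "tm \<Rightarrow> tm \<Rightarrow> tm" where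
  "inst u = sub (\<lambda>i. case i of 0 \<Rightarrow> u | Suc j \<Rightarrow> Var j)"

text \<open>The most recent declaration comes first; the type at position \<open>i\<close> lives in the
  context \<open>drop (Suc i) \<Gamma>\<close>, hence the weakening in \<open>relvar\<close>.\<close>

type_synonym ctxt = "(ann \<times> tm) list"

definition relvar :: "ctxt \<Rightarrow> nat \<Rightarrow> tm option" where
  "relvar \<Gamma> i =
    (if i < length \<Gamma> \<and> fst (\<Gamma> ! i) = Rel then Some (ren (\<lambda>j. j + Suc i) (snd (\<Gamma> ! i))) else None)"

definition resurrect :: "ctxt \<Rightarrow> ctxt" where
  "resurrect \<Gamma> = map (\<lambda>(r, T). (Rel, T)) \<Gamma>"

text \<open>The context in which an argument with annotation \<open>r\<close> is checked:
  \<open>\<Gamma> \<turnstile> u \<div> U\<close> abbreviates \<open>resurrect \<Gamma> \<turnstile> u : U\<close>.\<close>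

definition argctx :: "ann \<Rightarrow> ctxt \<Rightarrow> ctxt" where
  "argctx r \<Gamma> = (case r of Rel \<Rightarrow> \<Gamma> | Irr \<Rightarrow> resurrect \<Gamma>)"

section \<open>Typing and judgemental equality\<close>

inductive ctx :: "ctxt \<Rightarrow> bool"
  and typing :: "ctxt \<Rightarrow> tm \<Rightarrow> tm \<Rightarrow> bool"  ("_ \<turnstile> _ \<^bold>: _" [51, 51, 51] 50)
  and equal :: "ctxt \<Rightarrow> tm \<Rightarrow> tm \<Rightarrow> tm \<Rightarrow> bool"  ("_ \<turnstile> _ \<^bold>= _ \<^bold>: _" [51, 51, 51, 51] 50)
where
  ctx_nil: "ctx []"
| ctx_cons: "ctx \<Gamma> \<Longrightarrow> \<Gamma> \<turnstile> T \<^bold>: Sort s \<Longrightarrow> ctx ((r, T) # \<Gamma>)"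

| ty_sort: "ctx \<Gamma> \<Longrightarrow> (s, s') \<in> Axiom \<Longrightarrow> \<Gamma> \<turnstile> Sort s \<^bold>: Sort s'"
| ty_pi: "\<Gamma> \<turnstile> U \<^bold>: Sort s1 \<Longrightarrow> (r, U) # \<Gamma> \<turnstile> T \<^bold>: Sort s2 \<Longrightarrow> (s1, s2, s3) \<in> Rule
    \<Longrightarrow> \<Gamma> \<turnstile> Pi r s1 s2 U T \<^bold>: Sort s3"
| ty_var: "ctx \<Gamma> \<Longrightarrow> relvar \<Gamma> i = Some U \<Longrightarrow> \<Gamma> \<turnstile> Var i \<^bold>: U"
| ty_lam: "(r, U) # \<Gamma> \<turnstile> t \<^bold>: T \<Longrightarrow> \<Gamma> \<turnstile> Pi r s s' U T \<^bold>: Sort s''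
    \<Longrightarrow> \<Gamma> \<turnstile> Lam r U t \<^bold>: Pi r s s' U T"
| ty_app: "\<Gamma> \<turnstile> t \<^bold>: Pi r s s' U T \<Longrightarrow> argctx r \<Gamma> \<turnstile> u \<^bold>: U
    \<Longrightarrow> \<Gamma> \<turnstile> App r t u \<^bold>: inst u T"
| ty_conv: "\<Gamma> \<turnstile> t \<^bold>: T \<Longrightarrow> \<Gamma> \<turnstile> T \<^bold>= T' \<^bold>: Sort s \<Longrightarrow> \<Gamma> \<turnstile> t \<^bold>: T'"

| eq_beta: "(r, U) # \<Gamma> \<turnstile> t \<^bold>: T \<Longrightarrow> argctx r \<Gamma> \<turnstile> u \<^bold>: U
    \<Longrightarrow> \<Gamma> \<turnstile> App r (Lam r U t) u \<^bold>= inst u t \<^bold>: inst u T"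
| eq_eta: "\<Gamma> \<turnstile> t \<^bold>: Pi r s s' U T
    \<Longrightarrow> \<Gamma> \<turnstile> t \<^bold>= Lam r U (App r (ren Suc t) (Var 0)) \<^bold>: Pi r s s' U T"
| eq_refl: "\<Gamma> \<turnstile> t \<^bold>: T \<Longrightarrow> \<Gamma> \<turnstile> t \<^bold>= t \<^bold>: T"
| eq_sym: "\<Gamma> \<turnstile> t \<^bold>= t' \<^bold>: T \<Longrightarrow> \<Gamma> \<turnstile> t' \<^bold>= t \<^bold>: T"
| eq_trans: "\<Gamma> \<turnstile> t1 \<^bold>= t2 \<^bold>: T \<Longrightarrow> \<Gamma> \<turnstile> t2 \<^bold>= t3 \<^bold>: T \<Longrightarrow> \<Gamma> \<turnstile> t1 \<^bold>= t3 \<^bold>: T"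
| eq_pi: "\<Gamma> \<turnstile> U \<^bold>= U' \<^bold>: Sort s1 \<Longrightarrow> (r, U) # \<Gamma> \<turnstile> T \<^bold>= T' \<^bold>: Sort s2 \<Longrightarrow> (s1, s2, s3) \<in> Rule
    \<Longrightarrow> \<Gamma> \<turnstile> Pi r s1 s2 U T \<^bold>= Pi r s1 s2 U' T' \<^bold>: Sort s3"
| eq_lam: "\<Gamma> \<turnstile> U \<^bold>= U' \<^bold>: Sort s1 \<Longrightarrow> (r, U) # \<Gamma> \<turnstile> T \<^bold>: Sort s2 \<Longrightarrow> (r, U) # \<Gamma> \<turnstile> t \<^bold>= t' \<^bold>: T
    \<Longrightarrow> \<Gamma> \<turnstile> Lam r U t \<^bold>= Lam r U' t' \<^bold>: Pi r s1 s2 U T"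
| eq_app_rel: "\<Gamma> \<turnstile> t \<^bold>= t' \<^bold>: Pi Rel s s' U T \<Longrightarrow> \<Gamma> \<turnstile> u \<^bold>= u' \<^bold>: U
    \<Longrightarrow> \<Gamma> \<turnstile> App Rel t u \<^bold>= App Rel t' u' \<^bold>: inst u T"
| eq_app_irr: "\<Gamma> \<turnstile> t \<^bold>= t' \<^bold>: Pi Irr s s' U T \<Longrightarrow> resurrect \<Gamma> \<turnstile> u \<^bold>: U \<Longrightarrow> resurrect \<Gamma> \<turnstile> u' \<^bold>: U
    \<Longrightarrow> \<Gamma> \<turnstile> App Irr t u \<^bold>= App Irr t' u' \<^bold>: inst u T"
| eq_conv: "\<Gamma> \<turnstile> t \<^bold>= t' \<^bold>: T \<Longrightarrow> \<Gamma> \<turnstile> T \<^bold>= T' \<^bold>: Sort s \<Longrightarrow> \<Gamma> \<turnstile> t \<^bold>= t' \<^bold>: T'"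

section \<open>Weak head evaluation\<close>

fun neutral :: "tm \<Rightarrow> bool" where
  "neutral (Var i) = True"
| "neutral (App r n u) = neutral n"
| "neutral _ = False"

fun whnf :: "tm \<Rightarrow> bool" where
  "whnf (Sort s) = True"
| "whnf (Pi r s s' U T) = True"
| "whnf (Lam r U t) = True"
| "whnf n = neutral n"

inductive eval :: "tm \<Rightarrow> tm \<Rightarrow> bool"
  and evalapp :: "tm \<Rightarrow> ann \<Rightarrow> tm \<Rightarrow> tm \<Rightarrow> bool"
where
  ev_whnf: "whnf a \<Longrightarrow> eval a a"
| ev_app: "eval t f \<Longrightarrow> evalapp f r u a \<Longrightarrow> eval (App r t u) a"
| ev_beta: "eval (inst u t) a \<Longrightarrow> evalapp (Lam r U t) r u a"
| ev_neutral: "neutral n \<Longrightarrow> evalapp n r u (App r n u)"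

text \<open>Computations that may diverge (\<open>None\<close>), fail (\<open>Some Fail\<close>), or return a value
  (\<open>Some (Ok x)\<close>). In sequential composition neither divergence nor failure of the first
  computation lets the second one run. The \<open>partial_function\<close> definitions below are least
  fixed points with respect to the order with bottom \<open>None\<close>, so \<open>None\<close> is the outcome
  exactly of the runs that do not halt.\<close>

datatype 'a result = Fail | Ok 'a

definition andthen :: "'a result option \<Rightarrow> ('a \<Rightarrow> 'b result option) \<Rightarrow> 'b result option"
    (infixl "\<then>" 54) where
  "m \<then> k = Option.bind m (\<lambda>x. case x of Fail \<Rightarrow> Some Fail | Ok y \<Rightarrow> k y)"

lemma andthen_mono [partial_function_mono]:
  assumes "mono_option B" and "\<And>y. mono_option (\<lambda>f. C y f)"
  shows "mono_option (\<lambda>f. B f \<then> (\<lambda>y. C y f))"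
  unfolding andthen_def
proof (rule bind_mono)
  show "mono_option (\<lambda>f. case x of Fail \<Rightarrow> Some Fail | Ok y \<Rightarrow> C y f)" for x
    using assms(2) by (cases x) (auto simp: option.const_mono)
qed (fact assms(1))

lemma andthen_eq_Ok: "(m \<then> k) = Some (Ok b) \<longleftrightarrow> (\<exists>a. m = Some (Ok a) \<and> k a = Some (Ok b))"
  by (cases m) (auto simp: andthen_def split: result.splits)

text \<open>The evaluator reading of the rules for \<open>eval\<close>. It fails where evaluation gets stuck
  because no rule applies, as in the application of a sort to an argument.\<close>

partial_function (option) whe :: "tm \<Rightarrow> tm result option" where
  "whe t = (case t of
      App r t1 u \<Rightarrow> whe t1 \<then> (\<lambda>f.
        if neutral f then Some (Ok (App r f u))
        else (case f of
            Lam r' U b \<Rightarrow> if r' = r then whe (inst u b) else Some Fail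
          | _ \<Rightarrow> Some Fail))
    | _ \<Rightarrow> Some (Ok t))"

lemma whe_imp_eval:
  assumes "whe t = Some x"
  shows "\<forall>a. x = Ok a \<longrightarrow> eval t a"
proof (rule whe.raw_induct[of "\<lambda>t x. \<forall>a. x = Ok a \<longrightarrow> eval t a", OF _ assms])
  fix whe t y
  assume 1: "\<And>t y. whe t = Some y \<Longrightarrow> \<forall>a. y = Ok a \<longrightarrow> eval t a"
    "(case t of
        App r t1 u \<Rightarrow> whe t1 \<then> (\<lambda>f.
          if neutral f then Some (Ok (App r f u))
          else (case f of
              Lam r' U b \<Rightarrow> if r' = r then whe (inst u b) else Some Fail
            | _ \<Rightarrow> Some Fail))
      | _ \<Rightarrow> Some (Ok t)) = Some y"
  show "\<forall>a. y = Ok a \<longrightarrow> eval t a"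
  proof (intro allI impI)
    fix a assume a: "y = Ok a"
    show "eval t a"
    proof (cases t)
      case (App r t1 u)
      from 1(2) App a obtain f where f: "whe t1 = Some (Ok f)"
        and k: "(if neutral f then Some (Ok (App r f u))
          else (case f of
              Lam r' U b \<Rightarrow> if r' = r then whe (inst u b) else Some Fail
            | _ \<Rightarrow> Some Fail)) = Some (Ok a)"
        by (auto simp: andthen_eq_Ok)
      from 1(1)[OF f] have ef: "eval t1 f" by simp
      show ?thesis
      proof (cases "neutral f")
        case True
        with k ef App show ?thesis by (auto intro: ev_app ev_neutral)
      next
        case False
        with k obtain U b where fl: "f = Lam r U b" and b: "whe (inst u b) = Some (Ok a)"
          by (auto split: tm.splits if_splits)
        from 1(1)[OF b] ef fl App show ?thesis by (auto intro: ev_app ev_beta)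
      qed
    qed (use 1(2) a in \<open>auto intro: ev_whnf\<close>)
  qed
qed

lemma whe_neutral: "neutral n \<Longrightarrow> whe n = Some (Ok n)"
  by (induction n) (simp_all add: whe.simps andthen_def)

lemma eval_imp_whe:
  "eval t a \<Longrightarrow> whe t = Some (Ok a)"
  "evalapp f r u a \<Longrightarrow> whe t1 = Some (Ok f) \<Longrightarrow> whe (App r t1 u) = Some (Ok a)"
proof (induction arbitrary: and t1 rule: eval_evalapp.inducts)
  case (ev_whnf a)
  then show ?case
  proof (cases a)
    case (App r n u)
    with ev_whnf show ?thesis by (intro whe_neutral) simp
  qed (simp_all add: whe.simps)
next
  case (ev_beta u t a r U)
  then show ?case by (subst whe.simps) (simp add: andthen_def)
next
  case (ev_neutral n r u)
  then show ?case by (subst whe.simps) (simp add: andthen_def)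
qed

lemma whe_iff_eval: "whe t = Some (Ok a) \<longleftrightarrow> eval t a"
  using whe_imp_eval eval_imp_whe(1) by blast

section \<open>Algorithmic equality\<close>

text \<open>The three queries come in pairs: \<open>TyQ\<close>, \<open>NeQ\<close>, \<open>TmQ\<close> are the double-arrow and
  \<open>TyW\<close>, \<open>NeW\<close>, \<open>TmW\<close> the corresponding single-arrow judgements.\<close>

datatype query =
    TyQ ctxt tm tm
  | TyW ctxt tm tm
  | NeQ ctxt tm tm
  | NeW ctxt tm tm
  | TmQ ctxt tm tm tm
  | TmW ctxt tm tm tm

text \<open>A successful \<open>NeQ\<close> or \<open>NeW\<close> query answers \<open>Ok (Some T)\<close> with the output type \<open>T\<close>,
  any other successful query answers \<open>Ok None\<close>. The mutual recursion is folded into a single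
  function on queries.\<close>

partial_function (option) alg :: "query \<Rightarrow> tm option result option" where
  "alg q = (case q of
      TyQ \<Delta> T T' \<Rightarrow> whe T \<then> (\<lambda>A. whe T' \<then> (\<lambda>A'. alg (TyW \<Delta> A A')))
    | TyW \<Delta> A A' \<Rightarrow>
        if neutral A \<and> neutral A' then alg (NeQ \<Delta> A A') \<then> (\<lambda>_. Some (Ok None))
        else (case (A, A') of
            (Sort s, Sort s') \<Rightarrow> if s = s' then Some (Ok None) else Some Fail
          | (Pi r s1 s2 U T, Pi r' s1' s2' U' T') \<Rightarrow>
              if r = r' \<and> s1 = s1' \<and> s2 = s2'
              then alg (TyQ \<Delta> U U') \<then> (\<lambda>_. alg (TyQ ((r, U) # \<Delta>) T T'))
              else Some Fail
          | _ \<Rightarrow> Some Fail)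
    | NeQ \<Delta> n n' \<Rightarrow>
        (case (n, n') of
            (Var i, Var j) \<Rightarrow>
              if i = j then (case relvar \<Delta> i of Some T \<Rightarrow> Some (Ok (Some T)) | None \<Rightarrow> Some Fail)
              else Some Fail
          | (App r m u, App r' m' u') \<Rightarrow>
              if r = r' then
                alg (NeW \<Delta> m m') \<then> (\<lambda>A.
                  case A of
                    Some (Pi r'' s s' U T) \<Rightarrow>
                      if r'' = r then
                        (case r of
                            Rel \<Rightarrow> alg (TmQ \<Delta> u u' U) \<then> (\<lambda>_. Some (Ok (Some (inst u T))))
                          | Irr \<Rightarrow> Some (Ok (Some (inst u T))))
                      else Some Fail
                  | _ \<Rightarrow> Some Fail)
              else Some Fail
          | _ \<Rightarrow> Some Fail)
    | NeW \<Delta> n n' \<Rightarrow>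
        alg (NeQ \<Delta> n n') \<then> (\<lambda>R.
          case R of
            Some T \<Rightarrow> whe T \<then> (\<lambda>A. Some (Ok (Some A)))
          | None \<Rightarrow> Some Fail)
    | TmQ \<Delta> t t' T \<Rightarrow> whe T \<then> (\<lambda>A. alg (TmW \<Delta> t t' A))
    | TmW \<Delta> t t' A \<Rightarrow>
        if neutral A then
          whe t \<then> (\<lambda>n. whe t' \<then> (\<lambda>n'. alg (NeQ \<Delta> n n') \<then> (\<lambda>_. Some (Ok None))))
        else (case A of
            Pi r s s' U T \<Rightarrow>
              alg (TmQ ((r, U) # \<Delta>) (App r (ren Suc t) (Var 0)) (App r (ren Suc t') (Var 0)) T)
          | Sort s \<Rightarrow> alg (TyQ \<Delta> t t')
          | _ \<Rightarrow> Some Fail))"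

definition terminates :: "query \<Rightarrow> bool" where
  "terminates q \<longleftrightarrow> (\<exists>res. alg q = Some res)"

end

theory Submission
  imports Defs
begin

text \<open>The proof builds a Kripke model directly on raw open terms; worlds are contexts and morphisms
  are renamings that preserve the declarations. A neutral term is good at a world if structural equality
  of it with any hereditarily normalizing neutral term halts there, in all extensions of the world.
  The model needs neither subject reduction nor injectivity of function types, because semantic
  type equality is injective by construction. Two observations keep it small.

  First, the types the algorithm works with are inferred from the left-hand term only, so
  semantic typing is needed only on the left; of the right-hand term it suffices that it is
  hereditarily normalizing, a property of raw terms that is stable under renaming and under
  application to a variable.

  Second, termination does not depend on how neutral terms are identified, so the model identifies all
  neutral types, and all elements of a neutral type.

  By reflection a neutral term whose inferred type is semantically equal to \<open>A\<close> belongs to \<open>A\<close>;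
  by reification every query with an element of \<open>A\<close> on the left halts. Well-typed terms
  belong to the interpretation of their type under all related substitutions, in particular under
  the identity.\<close>

section \<open>Renaming and substitution\<close>

text \<open>Structural equality compares two arguments at a type inferred from the left head. To
  know that the right argument has this type as well, one would normally invoke soundness of the
  algorithm; asking for hereditary normalization only cuts this dependency. The price is that
  evaluation may get stuck on the right, for instance when a function type is applied to a fresh
  variable, so success, failure and divergence of evaluation must be kept apart and shown invariant
  under renaming.

  A model that relates neutral terms by algorithmic equality would need symmetry and transitivity of
  the algorithm in order to consist of partial equivalences. Once all safe neutral terms are
  identified, these properties are immediate at neutral types.

  The element relation of \<open>Set j\<close> is type equality at level \<open>j\<close>. Hence the
  model is defined by recursion on the level, and claims about types together with their elements
  are proved by an outer induction on the level and an inner one on the derivation of the type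
  equation.\<close>

lemma up_ren_simps [simp]: "up_ren \<rho> 0 = 0" "up_ren \<rho> (Suc i) = Suc (\<rho> i)"
  by (simp_all add: up_ren_def)

lemma up_sub_simps [simp]: "up_sub \<sigma> 0 = Var 0" "up_sub \<sigma> (Suc i) = ren Suc (\<sigma> i)"
  by (simp_all add: up_sub_def)

lemma up_ren_comp: "up_ren \<rho>' \<circ> up_ren \<rho> = up_ren (\<rho>' \<circ> \<rho>)"
  by (rule ext) (simp add: up_ren_def split: nat.split)

lemma up_ren_id [simp]: "up_ren (\<lambda>i. i) = (\<lambda>i. i)"
  by (rule ext) (simp add: up_ren_def split: nat.split)

lemma ren_id [simp]: "ren (\<lambda>i. i) t = t"
  by (induction t) simp_all

lemma ren_ren: "ren \<rho>' (ren \<rho> t) = ren (\<rho>' \<circ> \<rho>) t"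
  by (induction t arbitrary: \<rho> \<rho>') (simp_all add: up_ren_comp)

lemma up_sub_up_ren: "up_sub \<sigma> \<circ> up_ren \<rho> = up_sub (\<sigma> \<circ> \<rho>)"
  by (rule ext) (simp add: up_ren_def up_sub_def split: nat.split)

lemma sub_ren: "sub \<sigma> (ren \<rho> t) = sub (\<sigma> \<circ> \<rho>) t"
  by (induction t arbitrary: \<rho> \<sigma>) (simp_all add: up_sub_up_ren)

lemma ren_up_sub: "ren (up_ren \<rho>) \<circ> up_sub \<sigma> = up_sub (ren \<rho> \<circ> \<sigma>)"
  by (rule ext) (simp add: up_sub_def ren_ren comp_def split: nat.split)

lemma ren_sub: "ren \<rho> (sub \<sigma> t) = sub (ren \<rho> \<circ> \<sigma>) t"
  by (induction t arbitrary: \<rho> \<sigma>) (simp_all add: ren_up_sub)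

lemma sub_up_sub: "sub (up_sub \<tau>) \<circ> up_sub \<sigma> = up_sub (sub \<tau> \<circ> \<sigma>)"
  by (rule ext) (simp add: up_sub_def sub_ren ren_sub comp_def split: nat.split)

lemma sub_sub: "sub \<tau> (sub \<sigma> t) = sub (sub \<tau> \<circ> \<sigma>) t"
  by (induction t arbitrary: \<tau> \<sigma>) (simp_all add: sub_up_sub)

lemma up_sub_Var [simp]: "up_sub Var = Var"
  by (rule ext) (simp add: up_sub_def split: nat.split)

lemma sub_Var [simp]: "sub Var t = t"
  by (induction t) simp_all

lemma sub_Var_comp: "sub (Var \<circ> \<rho>) t = ren \<rho> t"
  using sub_ren[of Var \<rho> t] by simp

lemma inst_eq: "inst u = sub (case_nat u Var)"
  by (simp add: inst_def)

lemma ren_case_nat: "ren \<rho> \<circ> case_nat u \<sigma> = case_nat (ren \<rho> u) (ren \<rho> \<circ> \<sigma>)"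
  by (rule ext) (simp split: nat.split)

lemma sub_case_nat: "sub \<tau> \<circ> case_nat u \<sigma> = case_nat (sub \<tau> u) (sub \<tau> \<circ> \<sigma>)"
  by (rule ext) (simp split: nat.split)

lemma case_nat_up_ren: "case_nat u \<sigma> \<circ> up_ren \<rho> = case_nat u (\<sigma> \<circ> \<rho>)"
  by (rule ext) (simp add: up_ren_def split: nat.split)

lemma case_nat_up_sub: "sub (case_nat u Var) \<circ> up_sub \<sigma> = case_nat u \<sigma>"
  by (rule ext) (simp add: up_sub_def sub_ren comp_def split: nat.split)

lemma inst_sub: "inst u (sub (up_sub \<sigma>) t) = sub (case_nat u \<sigma>) t"
  by (simp add: inst_eq sub_sub case_nat_up_sub)

text \<open>The left-hand side is the shape in which \<open>sem_fun\<close> presents the codomain of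
  a substituted function type; the right-hand side is a single extended substitution, to which
  validity of the codomain applies.\<close>

lemma inst_ren_sub: "inst u (ren (up_ren \<rho>) (sub (up_sub \<sigma>) t)) = sub (case_nat u (ren \<rho> \<circ> \<sigma>)) t"
  by (simp add: ren_sub ren_up_sub inst_sub)

lemma sub_inst: "sub \<sigma> (inst u t) = sub (case_nat (sub \<sigma> u) \<sigma>) t"
  by (simp add: inst_eq sub_sub sub_case_nat) (simp add: comp_def)

lemma ren_inst: "ren \<rho> (inst u t) = inst (ren \<rho> u) (ren (up_ren \<rho>) t)"
  by (simp add: inst_eq ren_sub sub_ren ren_case_nat case_nat_up_ren) (simp add: comp_def)

lemma case_nat_Var_id: "case_nat (Var 0) (Var \<circ> Suc) = Var"
  by (rule ext) (simp split: nat.split)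

text \<open>The semantic clauses instantiate a weakened codomain, whereas the algorithm goes under
  the binder; at the fresh variable the two agree.\<close>

lemma inst_Var_0 [simp]: "inst (Var 0) (ren (up_ren Suc) t) = t"
  by (simp add: inst_eq sub_ren case_nat_up_ren case_nat_Var_id)

section \<open>Weak head evaluation and renaming\<close>

lemma neutral_whnf: "neutral n \<Longrightarrow> whnf n"
  by (cases n) auto

lemma eval_neutral: "neutral n \<Longrightarrow> eval n n"
  by (simp add: ev_whnf neutral_whnf)

lemma eval_whnf: "eval t a \<Longrightarrow> whnf a" "evalapp f r u a \<Longrightarrow> whnf a"
  by (induction rule: eval_evalapp.inducts) auto

lemma eval_det: "eval t a \<Longrightarrow> eval t b \<Longrightarrow> a = b"
  by (metis whe_iff_eval option.inject result.inject)

lemma neutral_ren [simp]: "neutral (ren \<rho> t) = neutral t"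
  by (induction t) auto

lemma whe_App: "whe (App r t u) = whe t \<then> (\<lambda>f.
        if neutral f then Some (Ok (App r f u))
        else (case f of
            Lam r' U b \<Rightarrow> if r' = r then whe (inst u b) else Some Fail
          | _ \<Rightarrow> Some Fail))"
  by (subst whe.simps) simp

lemma andthen_simps [simp]:
  "Some Fail \<then> k = Some Fail" "Some (Ok x) \<then> k = k x" "None \<then> k = None"
  by (simp_all add: andthen_def)

lemma andthen_eq_Some:
  "(m \<then> k) = Some y \<longleftrightarrow> (m = Some Fail \<and> y = Fail) \<or> (\<exists>a. m = Some (Ok a) \<and> k a = Some y)"
  by (cases m) (auto simp: andthen_def split: result.splits)

text \<open>Renaming maps variables to variables, so it neither creates nor destroys redexes. The
  induction is on approximations of the least fixed point and therefore speaks of halting runs;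
  failures are included because \<open>wn\<close> accepts them.\<close>

lemma whe_ren_Some:
  assumes "whe t = Some x"
  shows "\<forall>\<rho>. whe (ren \<rho> t) = Some (map_result (ren \<rho>) x)"
proof (rule whe.raw_induct[of "\<lambda>t x. \<forall>\<rho>. whe (ren \<rho> t) = Some (map_result (ren \<rho>) x)", OF _ assms])
  fix w t y
  assume IH: "\<And>t y. w t = Some y \<Longrightarrow> \<forall>\<rho>. whe (ren \<rho> t) = Some (map_result (ren \<rho>) y)"
    and eq: "(case t of
        App r t1 u \<Rightarrow> w t1 \<then> (\<lambda>f.
          if neutral f then Some (Ok (App r f u))
          else (case f of
              Lam r' U b \<Rightarrow> if r' = r then w (inst u b) else Some Fail
            | _ \<Rightarrow> Some Fail))
      | _ \<Rightarrow> Some (Ok t)) = Some y"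
  show "\<forall>\<rho>. whe (ren \<rho> t) = Some (map_result (ren \<rho>) y)"
  proof
    fix \<rho>
    show "whe (ren \<rho> t) = Some (map_result (ren \<rho>) y)"
    proof (cases t)
      case (App r t1 u)
      from eq App consider "w t1 = Some Fail" "y = Fail"
        | f where "w t1 = Some (Ok f)" "(if neutral f then Some (Ok (App r f u))
          else (case f of
              Lam r' U b \<Rightarrow> if r' = r then w (inst u b) else Some Fail
            | _ \<Rightarrow> Some Fail)) = Some y"
        by (auto simp: andthen_eq_Some)
      then show ?thesis
      proof cases
        case 1
        with IH[of t1 Fail] App show ?thesis by (simp add: whe_App)
      next
        case (2 f)
        from IH[OF 2(1)] have w1: "whe (ren \<rho> t1) = Some (Ok (ren \<rho> f))" by simp
        show ?thesis
        proof (cases "neutral f")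
          case True
          with 2 w1 App show ?thesis by (auto simp: whe_App)
        next
          case False
          show ?thesis
          proof (cases f)
            case (Lam r' U b)
            show ?thesis
            proof (cases "r' = r")
              case True
              with 2 Lam have "w (inst u b) = Some y" by simp
              from IH[OF this] True Lam w1 App show ?thesis
                by (auto simp: whe_App ren_inst)
            next
              case False
              with 2 Lam w1 App show ?thesis by (auto simp: whe_App)
            qed
          qed (use 2 False w1 App in \<open>auto simp: whe_App\<close>)
        qed
      qed
    qed (use eq in \<open>auto simp: whe.simps\<close>)
  qed
qed

text \<open>The converse for halting, which gives preservation of divergence. The induction
  hypothesis is about an approximation \<open>w\<close>; the first conjunct carries along that
  results of \<open>w\<close> are results of \<open>whe\<close>, so that \<open>whe_ren_Some\<close>
  can identify the value of the head as a renamed one.\<close>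

lemma whe_unren_Some:
  assumes "whe s = Some x"
  shows "whe s = Some x \<and> (\<forall>t. s = ren \<rho> t \<longrightarrow> (\<exists>y. whe t = Some y))"
proof (rule whe.raw_induct[of "\<lambda>s x. whe s = Some x \<and> (\<forall>t. s = ren \<rho> t \<longrightarrow> (\<exists>y. whe t = Some y))",
      OF _ assms])
  fix w s x
  assume IH: "\<And>s x. w s = Some x \<Longrightarrow> whe s = Some x \<and> (\<forall>t. s = ren \<rho> t \<longrightarrow> (\<exists>y. whe t = Some y))"
    and eq: "(case s of
        App r t1 u \<Rightarrow> w t1 \<then> (\<lambda>f.
          if neutral f then Some (Ok (App r f u))
          else (case f of
              Lam r' U b \<Rightarrow> if r' = r then w (inst u b) else Some Fail
            | _ \<Rightarrow> Some Fail))
      | _ \<Rightarrow> Some (Ok s)) = Some x"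
  show "whe s = Some x \<and> (\<forall>t. s = ren \<rho> t \<longrightarrow> (\<exists>y. whe t = Some y))"
  proof (intro conjI allI impI)
    show "whe s = Some x"
    proof (cases s)
      case (App r t1 u)
      have le: "whe t = Some y" if "w t = Some y" for t y
        by (rule conjunct1[OF IH[OF that]])
      from App eq consider "w t1 = Some Fail" "x = Fail"
        | f where "w t1 = Some (Ok f)" "(if neutral f then Some (Ok (App r f u))
          else (case f of
              Lam r' U b \<Rightarrow> if r' = r then w (inst u b) else Some Fail
            | _ \<Rightarrow> Some Fail)) = Some x"
        by (auto simp: andthen_eq_Some)
      then show ?thesis
      proof cases
        case 1
        with le[OF 1(1)] App show ?thesis by (simp add: whe_App)
      next
        case (2 f)
        have "whe (App r t1 u) = Some x"
        proof (cases "\<not> neutral f \<and> (\<exists>U b. f = Lam r U b)")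
          case True
          then obtain U b where f: "f = Lam r U b" by blast
          with 2(2) have "whe (inst u b) = Some x" by (simp add: le)
          with le[OF 2(1)] f show ?thesis by (simp add: whe_App)
        next
          case False
          with 2(2) le[OF 2(1)] show ?thesis by (cases f) (auto simp: whe_App)
        qed
        with App show ?thesis by simp
      qed
    qed (use eq in \<open>simp_all add: whe.simps\<close>)
  next
    fix t assume s: "s = ren \<rho> t"
    show "\<exists>y. whe t = Some y"
    proof (cases t)
      case (App r t1 u)
      with eq s obtain y where "w (ren \<rho> t1) = Some y" by (auto simp: andthen_eq_Some)
      with IH obtain z where z: "whe t1 = Some z" "whe (ren \<rho> t1) = Some y" by blast
      show ?thesis
      proof (cases z)
        case Fail
        with z App show ?thesis by (simp add: whe_App)
      next
        case (Ok f)
        with whe_ren_Some[OF z(1)] z(2) have y: "y = Ok (ren \<rho> f)" by simp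
        show ?thesis
        proof (cases "neutral f")
          case True
          with Ok z App show ?thesis by (simp add: whe_App)
        next
          case False
          show ?thesis
          proof (cases f)
            case (Lam r' U b)
            show ?thesis
            proof (cases "r' = r")
              case True
              from \<open>w (ren \<rho> t1) = Some y\<close> y eq s App Lam True
              have "w (ren \<rho> (inst u b)) = Some x" by (simp add: ren_inst)
              with IH obtain v where "whe (inst u b) = Some v" by blast
              with Ok z App Lam True show ?thesis by (simp add: whe_App)
            next
              case False
              with Ok z App Lam show ?thesis by (simp add: whe_App)
            qed
          qed (use Ok z App False in \<open>auto simp: whe_App\<close>)
        qed
      qed
    qed (simp_all add: whe.simps)
  qed
qed

lemma whe_ren: "whe (ren \<rho> t) = map_option (map_result (ren \<rho>)) (whe t)"
proof (cases "whe t")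
  case None
  have "whe (ren \<rho> t) \<noteq> Some y" for y
  proof
    assume "whe (ren \<rho> t) = Some y"
    from conjunct2[OF whe_unren_Some[OF this, of \<rho>]] None show False by auto
  qed
  with None show ?thesis by (metis not_Some_eq option.simps(8))
next
  case (Some x)
  then show ?thesis using whe_ren_Some[of t x] by simp
qed

lemma map_result_eq_Ok: "map_result f x = Ok b \<longleftrightarrow> (\<exists>a. x = Ok a \<and> b = f a)"
  by (cases x) auto

lemma map_result_eq_Fail: "map_result f x = Fail \<longleftrightarrow> x = Fail"
  by (cases x) auto

lemma eval_ren: "eval t a \<Longrightarrow> eval (ren \<rho> t) (ren \<rho> a)"
  by (simp add: whe_iff_eval[symmetric] whe_ren)

lemma eval_ren_iff: "eval (ren \<rho> t) b \<longleftrightarrow> (\<exists>a. eval t a \<and> b = ren \<rho> a)"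
  by (auto simp: whe_iff_eval[symmetric] whe_ren map_result_eq_Ok)

text \<open>Takes the place of weak head reduction in the model: it contains beta steps at the head,
  is stable under renaming and under adding an argument, and preserves everything that evaluation
  can observe.\<close>

definition whe_eq :: "tm \<Rightarrow> tm \<Rightarrow> bool" where
  "whe_eq t t' \<longleftrightarrow> whe t = whe t'"

lemma whe_eq_eval: "whe_eq t t' \<Longrightarrow> eval t a = eval t' a"
  by (simp add: whe_eq_def whe_iff_eval[symmetric])

lemma whe_eq_ren: "whe_eq t t' \<Longrightarrow> whe_eq (ren \<rho> t) (ren \<rho> t')"
  by (simp add: whe_eq_def whe_ren)

lemma whe_eq_App: "whe_eq t t' \<Longrightarrow> whe_eq (App r t u) (App r t' u)"
  by (simp add: whe_eq_def whe_App)

lemma whe_eq_beta: "whe_eq (App r (Lam r U t) u) (inst u t)"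
  by (simp add: whe_eq_def whe_App whe.simps[of "Lam r U t"])

section \<open>Hereditarily normalizing terms\<close>

text \<open>Terms whose hereditary weak head evaluation halts. Failure of the evaluation is permitted,
  because the right-hand side of a query need not be well-typed at the type of the query.\<close>

inductive wn :: "tm \<Rightarrow> bool" and wne :: "tm \<Rightarrow> bool" where
  wn_fail: "whe t = Some Fail \<Longrightarrow> wn t"
| wn_sort: "eval t (Sort s) \<Longrightarrow> wn t"
| wn_pi: "eval t (Pi r s s' U T) \<Longrightarrow> wn U \<Longrightarrow> wn T \<Longrightarrow> wn t"
| wn_lam: "eval t (Lam r U b) \<Longrightarrow> wn b \<Longrightarrow> wn t"
| wn_ne: "eval t n \<Longrightarrow> wne n \<Longrightarrow> wn t"
| wne_var: "wne (Var i)"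
| wne_app: "wne n \<Longrightarrow> wn u \<Longrightarrow> wne (App r n u)"

inductive_cases wne_AppE: "wne (App r n u)"

lemma wne_neutral: "wne n \<Longrightarrow> neutral n"
proof (induction n)
  case (App r n u)
  then show ?case by (auto elim: wne_AppE)
qed (auto elim: wne.cases)

lemma wn_ren: "wn t \<Longrightarrow> wn (ren \<rho> t)" "wne n \<Longrightarrow> wne (ren \<rho> n)"
proof (induction arbitrary: \<rho> and \<rho> rule: wn_wne.inducts)
  case (wn_fail t)
  then show ?case by (simp add: wn_wne.wn_fail whe_ren)
next
  case (wn_sort t s)
  then show ?case by (metis eval_ren ren.simps(1) wn_wne.wn_sort)
next
  case (wn_pi t r s s' U T)
  then show ?case by (metis eval_ren ren.simps(2) wn_wne.wn_pi)
next
  case (wn_lam t r U b)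
  then show ?case by (metis eval_ren ren.simps(4) wn_wne.wn_lam)
next
  case (wn_ne t n)
  then show ?case by (metis eval_ren wn_wne.wn_ne)
qed (simp_all add: wn_wne.wne_var wn_wne.wne_app)

text \<open>Reification at function types normalizes \<open>ren Suc t\<close> applied to a fresh
  variable and must conclude something about \<open>t\<close>. Every value of a renamed term is a
  renamed value by \<open>eval_ren_iff\<close>, so the derivation can be pulled back.\<close>

lemma wn_unren:
  "wn s \<Longrightarrow> \<forall>\<rho> t. s = ren \<rho> t \<longrightarrow> wn t"
  "wne m \<Longrightarrow> \<forall>\<rho> n. m = ren \<rho> n \<longrightarrow> wne n"
proof (induction rule: wn_wne.inducts)
  case (wn_fail s)
  have "whe t = Some Fail" if "s = ren \<rho> t" for \<rho> t
    using wn_fail that by (simp add: whe_ren map_result_eq_Fail)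
  then show ?case by (auto intro: wn_wne.wn_fail)
next
  case (wn_sort s k)
  show ?case
  proof (intro allI impI)
    fix \<rho> t assume "s = ren \<rho> t"
    with wn_sort obtain a where "eval t a" "Sort k = ren \<rho> a" by (auto simp: eval_ren_iff)
    then show "wn t" by (cases a) (auto intro: wn_wne.wn_sort)
  qed
next
  case (wn_pi s r s1 s2 U T)
  show ?case
  proof (intro allI impI)
    fix \<rho> t assume "s = ren \<rho> t"
    with wn_pi obtain a where "eval t a" "Pi r s1 s2 U T = ren \<rho> a" by (auto simp: eval_ren_iff)
    with wn_pi.IH show "wn t" by (cases a) (auto intro: wn_wne.wn_pi)
  qed
next
  case (wn_lam s r U b)
  show ?case
  proof (intro allI impI)
    fix \<rho> t assume "s = ren \<rho> t"
    with wn_lam obtain a where "eval t a" "Lam r U b = ren \<rho> a" by (auto simp: eval_ren_iff)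
    with wn_lam.IH show "wn t" by (cases a) (auto intro: wn_wne.wn_lam)
  qed
next
  case (wn_ne s n)
  show ?case
  proof (intro allI impI)
    fix \<rho> t assume "s = ren \<rho> t"
    with wn_ne obtain a where "eval t a" "n = ren \<rho> a" by (auto simp: eval_ren_iff)
    with wn_ne.IH show "wn t" by (blast intro: wn_wne.wn_ne)
  qed
next
  case (wne_var i)
  show ?case
  proof (intro allI impI)
    fix \<rho> n assume "Var i = ren \<rho> n"
    then show "wne n" by (cases n) (auto intro: wn_wne.wne_var)
  qed
next
  case (wne_app n u r)
  show ?case
  proof (intro allI impI)
    fix \<rho> m assume "App r n u = ren \<rho> m"
    with wne_app.IH show "wne m" by (cases m) (auto intro: wn_wne.wne_app)
  qed
qed

lemma wn_cases:
  assumes "wn t"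
  obtains "whe t = Some Fail"
  | s where "eval t (Sort s)"
  | r s s' U T where "eval t (Pi r s s' U T)" "wn U" "wn T"
  | r U b where "eval t (Lam r U b)" "wn b"
  | n where "eval t n" "wne n" "neutral n"
  using assms
proof cases
  case (wn_ne n)
  then show ?thesis by (intro that(5) wne_neutral)
qed (erule that; assumption)+

lemma wn_halts:
  assumes "wn t"
  shows "\<exists>x. whe t = Some x"
  using assms by (cases rule: wn_cases) (auto simp: whe_iff_eval[symmetric])

lemma wn_eval:
  assumes "wn t" "eval t a"
  shows "wn a"
proof -
  have a: "eval a a" using assms(2) eval_whnf(1) ev_whnf by blast
  from assms(1) show ?thesis
  proof (cases rule: wn_cases)
    case 1
    with assms(2) show ?thesis by (simp add: whe_iff_eval[symmetric])
  next
    case (2 s)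
    then show ?thesis using a eval_det[OF assms(2)] by (auto intro: wn_sort)
  next
    case (3 r s s' U T)
    then show ?thesis using a eval_det[OF assms(2) 3(1)] by (simp add: wn_pi)
  next
    case (4 r U b)
    then show ?thesis using a eval_det[OF assms(2) 4(1)] by (simp add: wn_lam)
  next
    case (5 n)
    then show ?thesis using a eval_det[OF assms(2) 5(1)] by (simp add: wn_ne)
  qed
qed


lemma wne_wn: "wne n \<Longrightarrow> wn n"
  by (rule wn_ne[OF eval_neutral[OF wne_neutral]])

lemma wn_whe_eq:
  assumes "wn t" "whe_eq s t"
  shows "wn s"
  using assms(1)
proof cases
  case wn_fail
  with assms(2) show ?thesis by (simp add: whe_eq_def wn_wne.wn_fail)
qed (use whe_eq_eval[OF assms(2)] wn_wne.intros in blast)+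

lemma wn_of_eval:
  assumes "wn a" "eval t a"
  shows "wn t"
proof (rule wn_whe_eq[OF assms(1)])
  have "eval a a" using assms(2) eval_whnf(1) ev_whnf by blast
  with assms(2) show "whe_eq t a" by (simp add: whe_eq_def whe_iff_eval[symmetric])
qed

section \<open>The Kripke model\<close>

text \<open>The equation also covers \<open>None\<close>: an irrelevant variable must stay irrelevant, since
  queries on it are required to fail.\<close>

definition weakens :: "(nat \<Rightarrow> nat) \<Rightarrow> ctxt \<Rightarrow> ctxt \<Rightarrow> bool" where
  "weakens \<rho> \<Delta> \<Delta>' \<longleftrightarrow> (\<forall>i. relvar \<Delta>' (\<rho> i) = map_option (ren \<rho>) (relvar \<Delta> i))"

lemma weakens_id: "weakens (\<lambda>i. i) \<Delta> \<Delta>"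
proof -
  have "ren (\<lambda>i. i) = (\<lambda>t. t)" by (rule ext) simp
  then show ?thesis by (simp add: weakens_def option.map_ident)
qed

lemma weakens_comp: "weakens \<rho> \<Delta> \<Delta>' \<Longrightarrow> weakens \<rho>' \<Delta>' \<Delta>'' \<Longrightarrow> weakens (\<rho>' \<circ> \<rho>) \<Delta> \<Delta>''"
  by (simp add: weakens_def option.map_comp comp_def ren_ren)

lemma relvar_Suc: "relvar ((r, U) # \<Delta>) (Suc i) = map_option (ren Suc) (relvar \<Delta> i)"
  by (simp add: relvar_def ren_ren comp_def)

lemma relvar_0: "relvar ((r, U) # \<Delta>) 0 = (if r = Rel then Some (ren Suc U) else None)"
  by (simp add: relvar_def)

lemma weakens_Suc: "weakens Suc \<Delta> ((r, U) # \<Delta>)"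
  by (simp add: weakens_def relvar_Suc)

text \<open>Here \<open>m\<close> may be any weak head normal form: at a neutral type the right-hand
  term is evaluated without knowing that it has this type, so its value need not be neutral.\<close>

definition safe :: "ctxt \<Rightarrow> tm \<Rightarrow> bool" where
  "safe \<Delta> n \<longleftrightarrow> wne n \<and> (\<forall>\<rho> \<Delta>' m. weakens \<rho> \<Delta> \<Delta>' \<longrightarrow> whnf m \<longrightarrow> wn m
    \<longrightarrow> terminates (NeQ \<Delta>' (ren \<rho> n) m))"

lemma safe_ren: "safe \<Delta> n \<Longrightarrow> weakens \<rho> \<Delta> \<Delta>' \<Longrightarrow> safe \<Delta>' (ren \<rho> n)"
  by (auto simp: safe_def wn_ren ren_ren dest: weakens_comp)

lemma safe_neutral: "safe \<Delta> n \<Longrightarrow> neutral n"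
  by (simp add: safe_def wne_neutral)

text \<open>Mirrors judgemental equality at an irrelevant declaration, where two terms are equal as
  soon as each of them has the type.\<close>

definition arg :: "ann \<Rightarrow> (tm \<Rightarrow> tm \<Rightarrow> bool) \<Rightarrow> tm \<Rightarrow> tm \<Rightarrow> bool" where
  "arg r R u u' \<longleftrightarrow> (case r of Rel \<Rightarrow> R u u' | Irr \<Rightarrow> R u u \<and> R u' u')"

text \<open>An inductive-recursive universe encoded as an inductive relation: the last argument is the
  interpretation of the type, and \<open>V\<close> supplies the universes below level \<open>i\<close>.\<close>

inductive semty :: "(nat \<Rightarrow> ctxt \<Rightarrow> tm \<Rightarrow> tm \<Rightarrow> bool) \<Rightarrow> nat \<Rightarrow> ctxt \<Rightarrow> tm \<Rightarrow> tm
    \<Rightarrow> (tm \<Rightarrow> tm \<Rightarrow> bool) \<Rightarrow> bool" for V i where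
  sem_sort: "eval A (Sort (Set j)) \<Longrightarrow> eval A' (Sort (Set j)) \<Longrightarrow> j < i
    \<Longrightarrow> semty V i \<Delta> A A' (V j \<Delta>)"
| sem_ne: "eval A N \<Longrightarrow> eval A' N' \<Longrightarrow> safe \<Delta> N \<Longrightarrow> safe \<Delta> N'
    \<Longrightarrow> semty V i \<Delta> A A' (\<lambda>t t'. \<exists>n n'. eval t n \<and> eval t' n' \<and> safe \<Delta> n \<and> safe \<Delta> n')"
| sem_fun: "eval A (Pi r s s' U T) \<Longrightarrow> eval A' (Pi r s s' U' T')
    \<Longrightarrow> (\<And>\<rho> \<Delta>'. weakens \<rho> \<Delta> \<Delta>' \<Longrightarrow> semty V i \<Delta>' (ren \<rho> U) (ren \<rho> U') (RU \<rho> \<Delta>'))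
    \<Longrightarrow> (\<And>\<rho> \<Delta>' u u'. weakens \<rho> \<Delta> \<Delta>' \<Longrightarrow> arg r (RU \<rho> \<Delta>') u u'
        \<Longrightarrow> semty V i \<Delta>' (inst u (ren (up_ren \<rho>) T)) (inst u' (ren (up_ren \<rho>) T')) (RT \<rho> \<Delta>' u u'))
    \<Longrightarrow> semty V i \<Delta> A A' (\<lambda>f f'. \<forall>\<rho> \<Delta>' u u'. weakens \<rho> \<Delta> \<Delta>' \<longrightarrow> arg r (RU \<rho> \<Delta>') u u'
        \<longrightarrow> RT \<rho> \<Delta>' u u' (App r (ren \<rho> f) u) (App r (ren \<rho> f') u'))"

text \<open>The guard makes the recursion on levels well-founded. Since \<open>sem_sort\<close>
  consults \<open>V j\<close> only for \<open>j < i\<close>, the default \<open>bot\<close> is never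
  reached and \<open>tyeq_iff_Ty\<close> can drop the guard.\<close>

fun tyeq :: "nat \<Rightarrow> ctxt \<Rightarrow> tm \<Rightarrow> tm \<Rightarrow> bool" where
  "tyeq i = (\<lambda>\<Delta> A A'. \<exists>R. semty (\<lambda>j. if j < i then tyeq j else bot) i \<Delta> A A' R)"

declare tyeq.simps [simp del]

lemma semty_cong:
  assumes "semty V i \<Delta> A A' R" "\<And>j. j < i \<Longrightarrow> V j = V' j"
  shows "semty V' i \<Delta> A A' R"
  using assms(1)
proof induction
  case (sem_sort A j A' \<Delta>)
  then show ?case using assms(2) semty.sem_sort by metis
next
  case (sem_ne A N A' N' \<Delta>)
  then show ?case by (rule semty.sem_ne)
next
  case (sem_fun A r s s' U T A' U' T' \<Delta> RU RT)
  from sem_fun.hyps(1,2) sem_fun.IH show ?case by (rule semty.sem_fun)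
qed

abbreviation Ty :: "nat \<Rightarrow> ctxt \<Rightarrow> tm \<Rightarrow> tm \<Rightarrow> (tm \<Rightarrow> tm \<Rightarrow> bool) \<Rightarrow> bool" where
  "Ty \<equiv> semty tyeq"

lemma tyeq_iff_Ty: "tyeq i \<Delta> A A' \<longleftrightarrow> (\<exists>R. Ty i \<Delta> A A' R)"
proof -
  let ?V = "\<lambda>j. if j < i then tyeq j else bot"
  have "semty ?V i \<Delta> A A' R \<longleftrightarrow> Ty i \<Delta> A A' R" for R
    by (rule iffI; erule semty_cong; simp)
  then have "(\<exists>R. semty ?V i \<Delta> A A' R) \<longleftrightarrow> (\<exists>R. Ty i \<Delta> A A' R)" by blast
  then show ?thesis unfolding tyeq.simps[of i] .
qed

lemma Ty_tyeq: "Ty i \<Delta> A A' R \<Longrightarrow> tyeq i \<Delta> A A'"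
  by (rule iffD2[OF tyeq_iff_Ty]) (rule exI)

section \<open>Inversion and determinacy of semantic type equality\<close>

lemma eval_clash:
  "eval A (Sort s) \<Longrightarrow> eval A (Pi r s1 s2 U T) \<Longrightarrow> False"
  "eval A (Sort s) \<Longrightarrow> eval A N \<Longrightarrow> safe \<Delta> N \<Longrightarrow> False"
  "eval A (Pi r s1 s2 U T) \<Longrightarrow> eval A N \<Longrightarrow> safe \<Delta> N \<Longrightarrow> False"
  by (drule (1) eval_det, auto dest: safe_neutral)+

lemma Ty_sort_inv:
  assumes "Ty i \<Delta> A A' R" "eval A (Sort (Set j)) \<or> eval A' (Sort (Set j))"
  shows "eval A (Sort (Set j)) \<and> eval A' (Sort (Set j)) \<and> j < i \<and> R = tyeq j \<Delta>"
  using assms(1)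
proof cases
  case (sem_sort k)
  with assms(2) have "k = j" by (auto dest: eval_det)
  with sem_sort show ?thesis by simp
qed (use assms(2) in \<open>auto dest: eval_clash\<close>)

lemma Ty_ne_inv:
  assumes "Ty i \<Delta> A A' R" "eval A N \<or> eval A' N" "safe \<Delta> N"
  shows "(\<exists>N N'. eval A N \<and> eval A' N' \<and> safe \<Delta> N \<and> safe \<Delta> N')
    \<and> R = (\<lambda>t t'. \<exists>n n'. eval t n \<and> eval t' n' \<and> safe \<Delta> n \<and> safe \<Delta> n')"
  using assms(1)
proof cases
  case (sem_ne N N')
  then show ?thesis by blast
qed (use assms(2,3) in \<open>auto dest: eval_clash\<close>)

lemma Ty_fun_inv:
  assumes "Ty i \<Delta> A A' R" "eval A (Pi r s s' U T)"
  shows "\<exists>U' T' RU RT. eval A' (Pi r s s' U' T')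
    \<and> (\<forall>\<rho> \<Delta>'. weakens \<rho> \<Delta> \<Delta>' \<longrightarrow> Ty i \<Delta>' (ren \<rho> U) (ren \<rho> U') (RU \<rho> \<Delta>'))
    \<and> (\<forall>\<rho> \<Delta>' u u'. weakens \<rho> \<Delta> \<Delta>' \<longrightarrow> arg r (RU \<rho> \<Delta>') u u'
        \<longrightarrow> Ty i \<Delta>' (inst u (ren (up_ren \<rho>) T)) (inst u' (ren (up_ren \<rho>) T')) (RT \<rho> \<Delta>' u u'))
    \<and> R = (\<lambda>f f'. \<forall>\<rho> \<Delta>' u u'. weakens \<rho> \<Delta> \<Delta>' \<longrightarrow> arg r (RU \<rho> \<Delta>') u u'
        \<longrightarrow> RT \<rho> \<Delta>' u u' (App r (ren \<rho> f) u) (App r (ren \<rho> f') u'))"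
  using assms(1)
proof cases
  case (sem_fun r0 s0 s0' U0 T0 U' T' RU RT)
  from eval_det[OF assms(2) sem_fun(2)] have "r0 = r" "s0 = s" "s0' = s'" "U0 = U" "T0 = T" by simp_all
  note sem_fun = sem_fun[unfolded this]
  show ?thesis
    by (rule exI[of _ U'], rule exI[of _ T'], rule exI[of _ RU], rule exI[of _ RT])
      (use sem_fun in blast)
qed (use assms(2) in \<open>auto dest: eval_clash\<close>)

lemma Ty_fun_inv':
  assumes "Ty i \<Delta> A A' R" "eval A' (Pi r s s' U' T')"
  shows "\<exists>U T RU RT. eval A (Pi r s s' U T)
    \<and> (\<forall>\<rho> \<Delta>'. weakens \<rho> \<Delta> \<Delta>' \<longrightarrow> Ty i \<Delta>' (ren \<rho> U) (ren \<rho> U') (RU \<rho> \<Delta>'))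
    \<and> (\<forall>\<rho> \<Delta>' u u'. weakens \<rho> \<Delta> \<Delta>' \<longrightarrow> arg r (RU \<rho> \<Delta>') u u'
        \<longrightarrow> Ty i \<Delta>' (inst u (ren (up_ren \<rho>) T)) (inst u' (ren (up_ren \<rho>) T')) (RT \<rho> \<Delta>' u u'))
    \<and> R = (\<lambda>f f'. \<forall>\<rho> \<Delta>' u u'. weakens \<rho> \<Delta> \<Delta>' \<longrightarrow> arg r (RU \<rho> \<Delta>') u u'
        \<longrightarrow> RT \<rho> \<Delta>' u u' (App r (ren \<rho> f) u) (App r (ren \<rho> f') u'))"
  using assms(1)
proof cases
  case (sem_fun r0 s0 s0' U T U0 T0 RU RT)
  from eval_det[OF assms(2) sem_fun(3)] have "r0 = r" "s0 = s" "s0' = s'" "U0 = U'" "T0 = T'" by simp_all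
  note sem_fun = sem_fun[unfolded this]
  show ?thesis
    by (rule exI[of _ U], rule exI[of _ T], rule exI[of _ RU], rule exI[of _ RT])
      (use sem_fun in blast)
qed (use assms(2) in \<open>auto dest: eval_clash\<close>)

text \<open>The families \<open>RU\<close> and \<open>RT\<close> of a derivation are arbitrary
  outside the reachable worlds and the related arguments, so two derivations can be shown to agree
  only there; the interpretation of the function type sees no more of them.\<close>

lemma fun_interp_cong:
  assumes "\<And>\<rho> \<Delta>'. weakens \<rho> \<Delta> \<Delta>' \<Longrightarrow> RU \<rho> \<Delta>' = RU' \<rho> \<Delta>'"
    and "\<And>\<rho> \<Delta>' u u'. weakens \<rho> \<Delta> \<Delta>' \<Longrightarrow> arg r (RU \<rho> \<Delta>') u u' \<Longrightarrow> RT \<rho> \<Delta>' u u' = RT' \<rho> \<Delta>' u u'"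
  shows "(\<lambda>f f'. \<forall>\<rho> \<Delta>' u u'. weakens \<rho> \<Delta> \<Delta>' \<longrightarrow> arg r (RU \<rho> \<Delta>') u u'
        \<longrightarrow> RT \<rho> \<Delta>' u u' (App r (ren \<rho> f) u) (App r (ren \<rho> f') u'))
    = (\<lambda>f f'. \<forall>\<rho> \<Delta>' u u'. weakens \<rho> \<Delta> \<Delta>' \<longrightarrow> arg r (RU' \<rho> \<Delta>') u u'
        \<longrightarrow> RT' \<rho> \<Delta>' u u' (App r (ren \<rho> f) u) (App r (ren \<rho> f') u'))"
  using assms by (intro ext) (metis (no_types, lifting))

text \<open>Evaluation is deterministic, so two derivations that share a side end in the same rule.
  At function types the interpretations of the domains agree first, which makes the codomain
  families comparable at the same arguments.\<close>

lemma Ty_det: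
  assumes "Ty i \<Delta> A A' R"
  shows "(\<forall>k B R'. Ty k \<Delta> A B R' \<longrightarrow> R = R') \<and> (\<forall>k B R'. Ty k \<Delta> B A' R' \<longrightarrow> R = R')"
  using assms
proof induction
  case (sem_sort A j A' \<Delta>)
  show ?case
  proof (intro conjI allI impI)
    show "tyeq j \<Delta> = R'" if "Ty k \<Delta> A B R'" for k B R'
      using Ty_sort_inv[OF that disjI1, OF sem_sort(1)] by simp
    show "tyeq j \<Delta> = R'" if "Ty k \<Delta> B A' R'" for k B R'
      using Ty_sort_inv[OF that disjI2, OF sem_sort(2)] by simp
  qed
next
  case (sem_ne A N A' N' \<Delta>)
  show ?case (is "(\<forall>k B R'. _ \<longrightarrow> ?R = R') \<and> _")
  proof (intro conjI allI impI)
    show "?R = R'" if "Ty k \<Delta> A B R'" for k B R'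
      using Ty_ne_inv[OF that disjI1, OF sem_ne(1,3)] by simp
    show "?R = R'" if "Ty k \<Delta> B A' R'" for k B R'
      using Ty_ne_inv[OF that disjI2, OF sem_ne(2,4)] by simp
  qed
next
  case (sem_fun A r s s' U T A' U' T' \<Delta> RU RT)
  show ?case
  proof (intro conjI allI impI, goal_cases)
    case (1 k B R')
    obtain U2 T2 RU2 RT2 where
      U2: "\<forall>\<rho> \<Delta>'. weakens \<rho> \<Delta> \<Delta>' \<longrightarrow> Ty k \<Delta>' (ren \<rho> U) (ren \<rho> U2) (RU2 \<rho> \<Delta>')"
      and T2: "\<forall>\<rho> \<Delta>' u u'. weakens \<rho> \<Delta> \<Delta>' \<longrightarrow> arg r (RU2 \<rho> \<Delta>') u u'
        \<longrightarrow> Ty k \<Delta>' (inst u (ren (up_ren \<rho>) T)) (inst u' (ren (up_ren \<rho>) T2)) (RT2 \<rho> \<Delta>' u u')"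
      and R': "R' = (\<lambda>f f'. \<forall>\<rho> \<Delta>' u u'. weakens \<rho> \<Delta> \<Delta>' \<longrightarrow> arg r (RU2 \<rho> \<Delta>') u u'
        \<longrightarrow> RT2 \<rho> \<Delta>' u u' (App r (ren \<rho> f) u) (App r (ren \<rho> f') u'))"
      using Ty_fun_inv[OF 1 sem_fun.hyps(1)] by blast
    have RU: "RU \<rho> \<Delta>' = RU2 \<rho> \<Delta>'" if "weakens \<rho> \<Delta> \<Delta>'" for \<rho> \<Delta>'
      using sem_fun.IH(1)[OF that] U2[rule_format, OF that] by blast
    show ?case unfolding R'
    proof (rule fun_interp_cong[OF RU])
      fix \<rho> \<Delta>' u u' assume w: "weakens \<rho> \<Delta> \<Delta>'" and a: "arg r (RU \<rho> \<Delta>') u u'"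
      from sem_fun.IH(2)[OF w a] T2[rule_format, OF w a[unfolded RU[OF w]]]
      show "RT \<rho> \<Delta>' u u' = RT2 \<rho> \<Delta>' u u'" by blast
    qed
  next
    case (2 k B R')
    obtain U2 T2 RU2 RT2 where
      U2: "\<forall>\<rho> \<Delta>'. weakens \<rho> \<Delta> \<Delta>' \<longrightarrow> Ty k \<Delta>' (ren \<rho> U2) (ren \<rho> U') (RU2 \<rho> \<Delta>')"
      and T2: "\<forall>\<rho> \<Delta>' u u'. weakens \<rho> \<Delta> \<Delta>' \<longrightarrow> arg r (RU2 \<rho> \<Delta>') u u'
        \<longrightarrow> Ty k \<Delta>' (inst u (ren (up_ren \<rho>) T2)) (inst u' (ren (up_ren \<rho>) T')) (RT2 \<rho> \<Delta>' u u')"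
      and R': "R' = (\<lambda>f f'. \<forall>\<rho> \<Delta>' u u'. weakens \<rho> \<Delta> \<Delta>' \<longrightarrow> arg r (RU2 \<rho> \<Delta>') u u'
        \<longrightarrow> RT2 \<rho> \<Delta>' u u' (App r (ren \<rho> f) u) (App r (ren \<rho> f') u'))"
      using Ty_fun_inv'[OF 2 sem_fun.hyps(2)] by blast
    have RU: "RU \<rho> \<Delta>' = RU2 \<rho> \<Delta>'" if "weakens \<rho> \<Delta> \<Delta>'" for \<rho> \<Delta>'
      using sem_fun.IH(1)[OF that] U2[rule_format, OF that] by blast
    show ?case unfolding R'
    proof (rule fun_interp_cong[OF RU])
      fix \<rho> \<Delta>' u u' assume w: "weakens \<rho> \<Delta> \<Delta>'" and a: "arg r (RU \<rho> \<Delta>') u u'"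
      from sem_fun.IH(2)[OF w a] T2[rule_format, OF w a[unfolded RU[OF w]]]
      show "RT \<rho> \<Delta>' u u' = RT2 \<rho> \<Delta>' u u'" by blast
    qed
  qed
qed

text \<open>By \<open>Ty_det\<close> the result is independent of the witnesses, the level included.
  This turns the relational encoding back into a function on types.\<close>

definition el :: "ctxt \<Rightarrow> tm \<Rightarrow> tm \<Rightarrow> tm \<Rightarrow> bool" where
  "el \<Delta> A t t' \<longleftrightarrow> (\<exists>i A' R. Ty i \<Delta> A A' R \<and> R t t')"

lemma el_eq:
  assumes "Ty i \<Delta> A A' R"
  shows "el \<Delta> A = R"
proof (intro ext iffI)
  fix t t'
  assume "el \<Delta> A t t'"
  then obtain k B R' where "Ty k \<Delta> A B R'" "R' t t'" by (auto simp: el_def)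
  moreover from this(1) assms have "R = R'" using Ty_det by blast
  ultimately show "R t t'" by simp
next
  fix t t'
  assume "R t t'"
  with assms show "el \<Delta> A t t'" unfolding el_def by blast
qed

lemma Ty_el:
  assumes "tyeq i \<Delta> A A'"
  shows "Ty i \<Delta> A A' (el \<Delta> A)"
proof -
  from assms obtain R where R: "Ty i \<Delta> A A' R" by (auto simp: tyeq_iff_Ty)
  with el_eq[OF R] show ?thesis by simp
qed

lemma tyeq_sort:
  assumes "eval A (Sort (Set j))" "eval A' (Sort (Set j))" "j < i"
  shows "tyeq i \<Delta> A A'"
  by (rule Ty_tyeq[OF sem_sort[OF assms]])

lemma tyeq_ne:
  assumes "eval A N" "eval A' N'" "safe \<Delta> N" "safe \<Delta> N'"
  shows "tyeq i \<Delta> A A'"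
  by (rule Ty_tyeq[OF sem_ne[OF assms]])

lemma el_sort: "eval A (Sort (Set j)) \<Longrightarrow> el \<Delta> A = tyeq j \<Delta>"
  by (rule el_eq[OF sem_sort[OF _ _ lessI]])

lemma el_ne:
  "eval A N \<Longrightarrow> safe \<Delta> N
    \<Longrightarrow> el \<Delta> A = (\<lambda>t t'. \<exists>n n'. eval t n \<and> eval t' n' \<and> safe \<Delta> n \<and> safe \<Delta> n')"
  by (rule el_eq, rule sem_ne)

text \<open>With \<open>el\<close> as the canonical choice for \<open>RU\<close> and
  \<open>RT\<close>, the function rule mentions only \<open>tyeq\<close> and \<open>el\<close>;
  \<open>tyeq_fun_inv\<close> and \<open>tyeq_induct\<close> do the same for inversion and
  induction.\<close>

lemma tyeq_fun:
  assumes "eval A (Pi r s s' U T)" "eval A' (Pi r s s' U' T')"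
    and U: "\<And>\<rho> \<Delta>'. weakens \<rho> \<Delta> \<Delta>' \<Longrightarrow> tyeq i \<Delta>' (ren \<rho> U) (ren \<rho> U')"
    and T: "\<And>\<rho> \<Delta>' u u'. weakens \<rho> \<Delta> \<Delta>' \<Longrightarrow> arg r (el \<Delta>' (ren \<rho> U)) u u'
        \<Longrightarrow> tyeq i \<Delta>' (inst u (ren (up_ren \<rho>) T)) (inst u' (ren (up_ren \<rho>) T'))"
  shows "tyeq i \<Delta> A A'"
proof -
  have "Ty i \<Delta> A A' (\<lambda>f f'. \<forall>\<rho> \<Delta>' u u'. weakens \<rho> \<Delta> \<Delta>' \<longrightarrow> arg r (el \<Delta>' (ren \<rho> U)) u u'
        \<longrightarrow> el \<Delta>' (inst u (ren (up_ren \<rho>) T)) (App r (ren \<rho> f) u) (App r (ren \<rho> f') u'))"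
    by (rule sem_fun[where RU="\<lambda>\<rho> \<Delta>'. el \<Delta>' (ren \<rho> U)"
          and RT="\<lambda>\<rho> \<Delta>' u u'. el \<Delta>' (inst u (ren (up_ren \<rho>) T))", OF assms(1,2)])
      (blast intro: Ty_el U T)+
  then show ?thesis by (rule Ty_tyeq)
qed

lemma tyeq_fun_inv:
  assumes "tyeq i \<Delta> A A'" "eval A (Pi r s s' U T)"
  shows "\<exists>U' T'. eval A' (Pi r s s' U' T')
    \<and> (\<forall>\<rho> \<Delta>'. weakens \<rho> \<Delta> \<Delta>' \<longrightarrow> tyeq i \<Delta>' (ren \<rho> U) (ren \<rho> U'))
    \<and> (\<forall>\<rho> \<Delta>' u u'. weakens \<rho> \<Delta> \<Delta>' \<longrightarrow> arg r (el \<Delta>' (ren \<rho> U)) u u'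
        \<longrightarrow> tyeq i \<Delta>' (inst u (ren (up_ren \<rho>) T)) (inst u' (ren (up_ren \<rho>) T')))
    \<and> el \<Delta> A = (\<lambda>f f'. \<forall>\<rho> \<Delta>' u u'. weakens \<rho> \<Delta> \<Delta>' \<longrightarrow> arg r (el \<Delta>' (ren \<rho> U)) u u'
        \<longrightarrow> el \<Delta>' (inst u (ren (up_ren \<rho>) T)) (App r (ren \<rho> f) u) (App r (ren \<rho> f') u'))"
proof -
  from assms(1) obtain R where R: "Ty i \<Delta> A A' R" by (auto simp: tyeq_iff_Ty)
  obtain U' T' RU RT where A': "eval A' (Pi r s s' U' T')"
    and U: "\<forall>\<rho> \<Delta>'. weakens \<rho> \<Delta> \<Delta>' \<longrightarrow> Ty i \<Delta>' (ren \<rho> U) (ren \<rho> U') (RU \<rho> \<Delta>')"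
    and T: "\<forall>\<rho> \<Delta>' u u'. weakens \<rho> \<Delta> \<Delta>' \<longrightarrow> arg r (RU \<rho> \<Delta>') u u'
        \<longrightarrow> Ty i \<Delta>' (inst u (ren (up_ren \<rho>) T)) (inst u' (ren (up_ren \<rho>) T')) (RT \<rho> \<Delta>' u u')"
    and R_eq: "R = (\<lambda>f f'. \<forall>\<rho> \<Delta>' u u'. weakens \<rho> \<Delta> \<Delta>' \<longrightarrow> arg r (RU \<rho> \<Delta>') u u'
        \<longrightarrow> RT \<rho> \<Delta>' u u' (App r (ren \<rho> f) u) (App r (ren \<rho> f') u'))"
    using Ty_fun_inv[OF R assms(2)] by blast
  have RU: "RU \<rho> \<Delta>' = el \<Delta>' (ren \<rho> U)" if "weakens \<rho> \<Delta> \<Delta>'" for \<rho> \<Delta>'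
    using el_eq[OF U[rule_format, OF that]] by simp
  have RT: "RT \<rho> \<Delta>' u u' = el \<Delta>' (inst u (ren (up_ren \<rho>) T))"
    if "weakens \<rho> \<Delta> \<Delta>'" "arg r (RU \<rho> \<Delta>') u u'" for \<rho> \<Delta>' u u'
    using el_eq[OF T[rule_format, OF that]] by simp
  have elA: "el \<Delta> A = (\<lambda>f f'. \<forall>\<rho> \<Delta>' u u'. weakens \<rho> \<Delta> \<Delta>' \<longrightarrow> arg r (el \<Delta>' (ren \<rho> U)) u u'
        \<longrightarrow> el \<Delta>' (inst u (ren (up_ren \<rho>) T)) (App r (ren \<rho> f) u) (App r (ren \<rho> f') u'))"
    unfolding el_eq[OF R] R_eq by (rule fun_interp_cong[OF RU RT])
  show ?thesis
  proof (rule exI[of _ U'], rule exI[of _ T'], intro conjI A' elA allI impI)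
    fix \<rho> \<Delta>' assume w: "weakens \<rho> \<Delta> \<Delta>'"
    show "tyeq i \<Delta>' (ren \<rho> U) (ren \<rho> U')"
      by (rule Ty_tyeq[OF U[rule_format, OF w]])
    fix u u' assume "arg r (el \<Delta>' (ren \<rho> U)) u u'"
    with RU[OF w] have a: "arg r (RU \<rho> \<Delta>') u u'" by simp
    show "tyeq i \<Delta>' (inst u (ren (up_ren \<rho>) T)) (inst u' (ren (up_ren \<rho>) T'))"
      by (rule Ty_tyeq[OF T[rule_format, OF w a]])
  qed
qed

lemma tyeq_induct [consumes 1, case_names sort ne func]:
  assumes "tyeq i \<Delta> A A'"
    and "\<And>\<Delta> A A' j. eval A (Sort (Set j)) \<Longrightarrow> eval A' (Sort (Set j)) \<Longrightarrow> j < i \<Longrightarrow> P \<Delta> A A'"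
    and "\<And>\<Delta> A A' N N'. eval A N \<Longrightarrow> eval A' N' \<Longrightarrow> safe \<Delta> N \<Longrightarrow> safe \<Delta> N' \<Longrightarrow> P \<Delta> A A'"
    and fn: "\<And>\<Delta> A A' r s s' U T U' T'. tyeq i \<Delta> A A' \<Longrightarrow>
      eval A (Pi r s s' U T) \<Longrightarrow> eval A' (Pi r s s' U' T') \<Longrightarrow>
      (\<And>\<rho> \<Delta>'. weakens \<rho> \<Delta> \<Delta>' \<Longrightarrow> tyeq i \<Delta>' (ren \<rho> U) (ren \<rho> U')) \<Longrightarrow>
      (\<And>\<rho> \<Delta>'. weakens \<rho> \<Delta> \<Delta>' \<Longrightarrow> P \<Delta>' (ren \<rho> U) (ren \<rho> U')) \<Longrightarrow>
      (\<And>\<rho> \<Delta>' u u'. weakens \<rho> \<Delta> \<Delta>' \<Longrightarrow> arg r (el \<Delta>' (ren \<rho> U)) u u'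
        \<Longrightarrow> tyeq i \<Delta>' (inst u (ren (up_ren \<rho>) T)) (inst u' (ren (up_ren \<rho>) T'))) \<Longrightarrow>
      (\<And>\<rho> \<Delta>' u u'. weakens \<rho> \<Delta> \<Delta>' \<Longrightarrow> arg r (el \<Delta>' (ren \<rho> U)) u u'
        \<Longrightarrow> P \<Delta>' (inst u (ren (up_ren \<rho>) T)) (inst u' (ren (up_ren \<rho>) T'))) \<Longrightarrow> P \<Delta> A A'"
  shows "P \<Delta> A A'"
proof -
  from assms(1) obtain R where "Ty i \<Delta> A A' R" by (auto simp: tyeq_iff_Ty)
  then show ?thesis
  proof induction
    case (sem_sort A j A' \<Delta>)
    then show ?case using assms(2) by blast
  next
    case (sem_ne A N A' N' \<Delta>)
    then show ?case using assms(3) by blast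
  next
    case (sem_fun A r s s' U T A' U' T' \<Delta> RU RT)
    have RU: "RU \<rho> \<Delta>' = el \<Delta>' (ren \<rho> U)" if "weakens \<rho> \<Delta> \<Delta>'" for \<rho> \<Delta>'
      using el_eq[OF sem_fun.hyps(3)[OF that]] by simp
    have "Ty i \<Delta> A A' (\<lambda>f f'. \<forall>\<rho> \<Delta>' u u'. weakens \<rho> \<Delta> \<Delta>' \<longrightarrow> arg r (RU \<rho> \<Delta>') u u'
        \<longrightarrow> RT \<rho> \<Delta>' u u' (App r (ren \<rho> f) u) (App r (ren \<rho> f') u'))"
      using sem_fun.hyps by (rule semty.sem_fun)
    then have "tyeq i \<Delta> A A'" by (rule Ty_tyeq)
    then show ?case
    proof (rule fn[OF _ sem_fun.hyps(1,2)])
      fix \<rho> \<Delta>' assume w: "weakens \<rho> \<Delta> \<Delta>'"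
      show "tyeq i \<Delta>' (ren \<rho> U) (ren \<rho> U')" "P \<Delta>' (ren \<rho> U) (ren \<rho> U')"
        by (rule Ty_tyeq[OF sem_fun.hyps(3)[OF w]]) (rule sem_fun.IH(1)[OF w])
      fix u u' assume "arg r (el \<Delta>' (ren \<rho> U)) u u'"
      with RU[OF w] have a: "arg r (RU \<rho> \<Delta>') u u'" by simp
      show "tyeq i \<Delta>' (inst u (ren (up_ren \<rho>) T)) (inst u' (ren (up_ren \<rho>) T'))"
        "P \<Delta>' (inst u (ren (up_ren \<rho>) T)) (inst u' (ren (up_ren \<rho>) T'))"
        by (rule Ty_tyeq[OF sem_fun.hyps(4)[OF w a]]) (rule sem_fun.IH(2)[OF w a])
    qed
  qed
qed


lemma el_fun:
  assumes "tyeq i \<Delta> A A'" "eval A (Pi r s s' U T)"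
  shows "el \<Delta> A f f' \<longleftrightarrow> (\<forall>\<rho> \<Delta>' u u'. weakens \<rho> \<Delta> \<Delta>' \<longrightarrow> arg r (el \<Delta>' (ren \<rho> U)) u u'
    \<longrightarrow> el \<Delta>' (inst u (ren (up_ren \<rho>) T)) (App r (ren \<rho> f) u) (App r (ren \<rho> f') u'))"
  using tyeq_fun_inv[OF assms] by (elim exE conjE) simp

lemma tyeq_sort_inv:
  "tyeq i \<Delta> A A' \<Longrightarrow> eval A (Sort (Set j)) \<Longrightarrow> eval A' (Sort (Set j)) \<and> j < i"
  using Ty_sort_inv[OF Ty_el] by blast

lemma tyeq_ne_inv:
  "tyeq i \<Delta> A A' \<Longrightarrow> eval A N \<Longrightarrow> safe \<Delta> N \<Longrightarrow> \<exists>N'. eval A' N' \<and> safe \<Delta> N'"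
  using Ty_ne_inv[OF Ty_el] by blast

lemma arg_sym: "symp R \<Longrightarrow> arg r R u u' \<Longrightarrow> arg r R u' u"
  by (cases r) (auto simp: arg_def dest: sympD)

lemma arg_left: "symp R \<Longrightarrow> transp R \<Longrightarrow> arg r R u u' \<Longrightarrow> arg r R u u"
  by (cases r) (auto simp: arg_def dest: sympD transpD)

lemma arg_right: "symp R \<Longrightarrow> transp R \<Longrightarrow> arg r R u u' \<Longrightarrow> arg r R u' u'"
  by (cases r) (auto simp: arg_def dest: sympD transpD)

text \<open>The clauses need each other at function types: exchanging the sides of a codomain
  equation requires symmetry of the domain and equal interpretations of both domains, and
  transitivity passes through the diagonal of the domain. The level \<open>k\<close> is arbitrary
  because an inferred type comes with an unknown level.\<close>

definition good_ty :: "nat \<Rightarrow> ctxt \<Rightarrow> tm \<Rightarrow> tm \<Rightarrow> bool" where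
  "good_ty i \<Delta> A A' \<longleftrightarrow> tyeq i \<Delta> A' A \<and> el \<Delta> A = el \<Delta> A' \<and> symp (el \<Delta> A) \<and> transp (el \<Delta> A)
    \<and> (\<forall>k B. tyeq k \<Delta> A' B \<longrightarrow> tyeq i \<Delta> A B)"

lemma good_ty_fun:
  assumes A: "tyeq i \<Delta> A A'" "eval A (Pi r s s' U T)" "eval A' (Pi r s s' U' T')"
    and U: "\<And>\<rho> \<Delta>'. weakens \<rho> \<Delta> \<Delta>' \<Longrightarrow> good_ty i \<Delta>' (ren \<rho> U) (ren \<rho> U')"
    and T: "\<And>\<rho> \<Delta>' u u'. weakens \<rho> \<Delta> \<Delta>' \<Longrightarrow> arg r (el \<Delta>' (ren \<rho> U)) u u'
        \<Longrightarrow> good_ty i \<Delta>' (inst u (ren (up_ren \<rho>) T)) (inst u' (ren (up_ren \<rho>) T'))"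
  shows "good_ty i \<Delta> A A'"
proof -
  let ?T = "\<lambda>\<rho> u. inst u (ren (up_ren \<rho>) T)" and ?T' = "\<lambda>\<rho> u. inst u (ren (up_ren \<rho>) T')"
  have elU: "el \<Delta>' (ren \<rho> U) = el \<Delta>' (ren \<rho> U')" "symp (el \<Delta>' (ren \<rho> U))" "transp (el \<Delta>' (ren \<rho> U))"
    if "weakens \<rho> \<Delta> \<Delta>'" for \<rho> \<Delta>'
    using U[OF that] unfolding good_ty_def by blast+
  have elT: "el \<Delta>' (?T \<rho> u) = el \<Delta>' (?T' \<rho> u')" "symp (el \<Delta>' (?T \<rho> u))" "transp (el \<Delta>' (?T \<rho> u))"
    if "weakens \<rho> \<Delta> \<Delta>'" "arg r (el \<Delta>' (ren \<rho> U)) u u'" for \<rho> \<Delta>' u u'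
    using T[OF that] unfolding good_ty_def by blast+
  \<comment> \<open>Both instances have the interpretation of \<open>T'\<close> at
    \<open>u'\<close>: one by the pair of \<open>u\<close> and \<open>u'\<close>, the other by
    \<open>u'\<close> paired with itself.\<close>
  have elTT: "el \<Delta>' (?T \<rho> u') = el \<Delta>' (?T \<rho> u)"
    if w: "weakens \<rho> \<Delta> \<Delta>'" and a: "arg r (el \<Delta>' (ren \<rho> U)) u u'" for \<rho> \<Delta>' u u'
    using elT(1)[OF w a] elT(1)[OF w arg_right[OF elU(2,3)[OF w] a]] by simp
  note elA = el_fun[OF A(1,2)]
  have sym: "tyeq i \<Delta> A' A"
  proof (rule tyeq_fun[OF A(3,2)])
    fix \<rho> \<Delta>' assume w: "weakens \<rho> \<Delta> \<Delta>'"
    then show "tyeq i \<Delta>' (ren \<rho> U') (ren \<rho> U)"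
      using U by (simp add: good_ty_def)
    fix u u' assume "arg r (el \<Delta>' (ren \<rho> U')) u u'"
    then have "arg r (el \<Delta>' (ren \<rho> U)) u' u" using elU[OF w] arg_sym by simp
    from T[OF w this] show "tyeq i \<Delta>' (?T' \<rho> u) (?T \<rho> u')" by (simp add: good_ty_def)
  qed
  have "el \<Delta> A' f f' \<longleftrightarrow> el \<Delta> A f f'" for f f'
    unfolding elA el_fun[OF sym A(3)] using elU(1) elT(1) arg_left[OF elU(2,3)] by metis
  then have el: "el \<Delta> A = el \<Delta> A'" by (intro ext) simp
  have "symp (el \<Delta> A)"
  proof (rule sympI)
    fix f f' assume f: "el \<Delta> A f f'"
    show "el \<Delta> A f' f" unfolding elA
    proof (intro allI impI)
      fix \<rho> \<Delta>' u u' assume w: "weakens \<rho> \<Delta> \<Delta>'" and a: "arg r (el \<Delta>' (ren \<rho> U)) u u'"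
      from arg_sym[OF elU(2)[OF w] a] have "arg r (el \<Delta>' (ren \<rho> U)) u' u" .
      with f w have "el \<Delta>' (?T \<rho> u') (App r (ren \<rho> f) u') (App r (ren \<rho> f') u)"
        unfolding elA by blast
      then show "el \<Delta>' (?T \<rho> u) (App r (ren \<rho> f') u) (App r (ren \<rho> f) u')"
        unfolding elTT[OF w a] by (rule sympD[OF elT(2)[OF w a]])
    qed
  qed
  moreover have "transp (el \<Delta> A)"
  proof (rule transpI)
    fix f f' f'' assume f: "el \<Delta> A f f'" "el \<Delta> A f' f''"
    show "el \<Delta> A f f''" unfolding elA
    proof (intro allI impI)
      fix \<rho> \<Delta>' u u' assume w: "weakens \<rho> \<Delta> \<Delta>'" and a: "arg r (el \<Delta>' (ren \<rho> U)) u u'"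
      \<comment> \<open>The passage from \<open>f\<close> to \<open>f'\<close> keeps the argument
        \<open>u\<close>; only the one from \<open>f'\<close> to \<open>f''\<close> changes it to
        \<open>u'\<close>.\<close>
      have "el \<Delta>' (?T \<rho> u) (App r (ren \<rho> f) u) (App r (ren \<rho> f') u)"
        using f(1) w arg_left[OF elU(2,3)[OF w] a] unfolding elA by blast
      moreover have "el \<Delta>' (?T \<rho> u) (App r (ren \<rho> f') u) (App r (ren \<rho> f'') u')"
        using f(2) w a unfolding elA by blast
      ultimately show "el \<Delta>' (?T \<rho> u) (App r (ren \<rho> f) u) (App r (ren \<rho> f'') u')"
        by (rule transpD[OF elT(3)[OF w a]])
    qed
  qed
  moreover have "tyeq i \<Delta> A B" if B: "tyeq k \<Delta> A' B" for k B
  proof -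
    from tyeq_fun_inv[OF B A(3)] obtain U2 T2 where B': "eval B (Pi r s s' U2 T2)"
      and U2: "\<forall>\<rho> \<Delta>'. weakens \<rho> \<Delta> \<Delta>' \<longrightarrow> tyeq k \<Delta>' (ren \<rho> U') (ren \<rho> U2)"
      and T2: "\<forall>\<rho> \<Delta>' u u'. weakens \<rho> \<Delta> \<Delta>' \<longrightarrow> arg r (el \<Delta>' (ren \<rho> U')) u u'
        \<longrightarrow> tyeq k \<Delta>' (?T' \<rho> u) (inst u' (ren (up_ren \<rho>) T2))" by blast
    show ?thesis
    proof (rule tyeq_fun[OF A(2) B'])
      fix \<rho> \<Delta>' assume w: "weakens \<rho> \<Delta> \<Delta>'"
      with U[OF w] U2 show "tyeq i \<Delta>' (ren \<rho> U) (ren \<rho> U2)"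
        unfolding good_ty_def by blast
      fix u u' assume a: "arg r (el \<Delta>' (ren \<rho> U)) u u'"
      from a have "arg r (el \<Delta>' (ren \<rho> U')) u u'" by (simp add: elU(1)[OF w])
      with T2 w have "tyeq k \<Delta>' (?T' \<rho> u) (inst u' (ren (up_ren \<rho>) T2))" by blast
      \<comment> \<open>The same device for types: from \<open>T\<close> to \<open>T'\<close> at the
        common argument \<open>u\<close>, then from \<open>T'\<close> at \<open>u\<close> to
        \<open>T2\<close> at \<open>u'\<close>.\<close>
      with T[OF w arg_left[OF elU(2,3)[OF w] a]]
      show "tyeq i \<Delta>' (?T \<rho> u) (inst u' (ren (up_ren \<rho>) T2))"
        unfolding good_ty_def by blast
    qed
  qed
  ultimately show ?thesis using sym el by (simp add: good_ty_def)
qed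

lemma tyeq_good: "tyeq i \<Delta> A A' \<Longrightarrow> good_ty i \<Delta> A A'"
proof (induction i arbitrary: \<Delta> A A' rule: less_induct)
  case (less i)
  from less.prems show ?case
  proof (induction rule: tyeq_induct)
    case (sort \<Delta> A A' j)
    have "symp (tyeq j \<Delta>)" "transp (tyeq j \<Delta>)"
      using less.IH[OF sort(3)] unfolding good_ty_def by (blast intro: sympI transpI)+
    moreover have "tyeq i \<Delta> A B" if "tyeq k \<Delta> A' B" for k B
      using tyeq_sort_inv[OF that sort(2)] tyeq_sort[OF sort(1) _ sort(3)] by blast
    ultimately show ?case
      using sort by (simp add: good_ty_def el_sort tyeq_sort)
  next
    case (ne \<Delta> A A' N N')
    have "tyeq i \<Delta> A B" if "tyeq k \<Delta> A' B" for k B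
      using tyeq_ne_inv[OF that ne(2,4)] tyeq_ne[OF ne(1) _ ne(3)] by blast
    moreover have "symp (el \<Delta> A)" "transp (el \<Delta> A)"
      unfolding el_ne[OF ne(1,3)] by (blast intro: sympI transpI)+
    moreover have "tyeq i \<Delta> A' A" using tyeq_ne[OF ne(2,1,4,3)] .
    ultimately show ?case
      by (simp add: good_ty_def el_ne[OF ne(1,3)] el_ne[OF ne(2,4)])
  next
    case (func \<Delta> A A' r s s' U T U' T')
    from func(1-3,6,7) show ?case by (rule good_ty_fun)
  qed
qed

lemma tyeq_sym: "tyeq i \<Delta> A A' \<Longrightarrow> tyeq i \<Delta> A' A"
  and el_cong: "tyeq i \<Delta> A A' \<Longrightarrow> el \<Delta> A = el \<Delta> A'"
  and el_symp: "tyeq i \<Delta> A A' \<Longrightarrow> symp (el \<Delta> A)"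
  and el_transp: "tyeq i \<Delta> A A' \<Longrightarrow> transp (el \<Delta> A)"
  and tyeq_trans: "tyeq i \<Delta> A A' \<Longrightarrow> tyeq k \<Delta> A' B \<Longrightarrow> tyeq i \<Delta> A B"
  using tyeq_good unfolding good_ty_def by blast+

lemma tyeq_left: "tyeq i \<Delta> A A' \<Longrightarrow> tyeq i \<Delta> A A"
  using tyeq_sym tyeq_trans by blast

lemma el_sym: "tyeq i \<Delta> A A' \<Longrightarrow> el \<Delta> A t t' \<Longrightarrow> el \<Delta> A t' t"
  by (blast dest: el_symp sympD)

lemma el_trans: "tyeq i \<Delta> A A' \<Longrightarrow> el \<Delta> A t t' \<Longrightarrow> el \<Delta> A t' t'' \<Longrightarrow> el \<Delta> A t t''"
  by (blast dest: el_transp transpD)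

text \<open>Domain and codomain of a function type live at different levels, and
  \<open>valid_Pi\<close> raises both to the maximum. Since \<open>el\<close> does not mention the
  level, the function case carries over unchanged.\<close>

lemma tyeq_mono: "tyeq i \<Delta> A A' \<Longrightarrow> i \<le> k \<Longrightarrow> tyeq k \<Delta> A A'"
proof (induction rule: tyeq_induct)
  case (sort \<Delta> A A' j)
  then show ?case using tyeq_sort less_le_trans by blast
next
  case (ne \<Delta> A A' N N')
  from ne(1-4) show ?case by (rule tyeq_ne)
next
  case (func \<Delta> A A' r s s' U T U' T')
  show ?case
    by (rule tyeq_fun[OF func(2,3)]) (use func in blast)+
qed

text \<open>The two claims are joined because the elements of a sort are types. At function types
  both follow by composing renamings, since the clauses quantify over all later worlds.\<close>

lemma tyeq_ren_and_el_ren: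
  assumes "tyeq i \<Delta> A A'" "weakens \<rho> \<Delta> \<Delta>'"
  shows "tyeq i \<Delta>' (ren \<rho> A) (ren \<rho> A') \<and>
    (\<forall>t t'. el \<Delta> A t t' \<longrightarrow> el \<Delta>' (ren \<rho> A) (ren \<rho> t) (ren \<rho> t'))"
  using assms
proof (induction i arbitrary: \<rho> \<Delta> \<Delta>' A A' rule: less_induct)
  case (less i)
  note w = less.prems(2)
  from less.prems show ?case
  proof (induction rule: tyeq_induct)
    case (sort \<Delta> A A' j)
    have e: "eval (ren \<rho> A) (Sort (Set j))" "eval (ren \<rho> A') (Sort (Set j))"
      using sort(1,2) eval_ren by fastforce+
    show ?case using less.IH[OF sort(3) _ sort(4)] tyeq_sort[OF e sort(3)]
      by (simp add: el_sort[OF e(1)] el_sort[OF sort(1)])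
  next
    case (ne \<Delta> A A' N N')
    note e = eval_ren[OF ne(1), of \<rho>] eval_ren[OF ne(2), of \<rho>]
      and sf = safe_ren[OF ne(3,5)] safe_ren[OF ne(4,5)]
    from tyeq_ne[OF e sf] safe_ren[OF _ ne(5)] eval_ren show ?case
      unfolding el_ne[OF e(1) sf(1)] el_ne[OF ne(1,3)] by blast
  next
    case (func \<Delta> A A' r s s' U T U' T')
    note e = eval_ren[OF func(2), of \<rho>, simplified] eval_ren[OF func(3), of \<rho>, simplified]
    have comp: "ren \<rho>' (ren \<rho> t) = ren (\<rho>' \<circ> \<rho>) t"
      "ren (up_ren \<rho>') (ren (up_ren \<rho>) t) = ren (up_ren (\<rho>' \<circ> \<rho>)) t" for \<rho>' t
      by (simp_all add: ren_ren up_ren_comp)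
    have ty: "tyeq i \<Delta>' (ren \<rho> A) (ren \<rho> A')"
    proof (rule tyeq_fun[OF e])
      fix \<rho>' \<Delta>'' assume "weakens \<rho>' \<Delta>' \<Delta>''"
      note w = weakens_comp[OF func(8) this]
      show "tyeq i \<Delta>'' (ren \<rho>' (ren \<rho> U)) (ren \<rho>' (ren \<rho> U'))"
        unfolding comp by (rule func(4)[OF w])
      fix u u' assume "arg r (el \<Delta>'' (ren \<rho>' (ren \<rho> U))) u u'"
      then show "tyeq i \<Delta>'' (inst u (ren (up_ren \<rho>') (ren (up_ren \<rho>) T)))
          (inst u' (ren (up_ren \<rho>') (ren (up_ren \<rho>) T')))"
        unfolding comp by (rule func(5)[OF w])
    qed
    moreover have "el \<Delta>' (ren \<rho> A) (ren \<rho> f) (ren \<rho> f')" if "el \<Delta> A f f'" for f f'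
      unfolding el_fun[OF ty e(1)] comp
      using that[unfolded el_fun[OF func(1,2)]] weakens_comp[OF func(8)] by blast
    ultimately show ?case by blast
  qed
qed

lemma tyeq_ren: "tyeq i \<Delta> A A' \<Longrightarrow> weakens \<rho> \<Delta> \<Delta>' \<Longrightarrow> tyeq i \<Delta>' (ren \<rho> A) (ren \<rho> A')"
  and el_ren: "tyeq i \<Delta> A A' \<Longrightarrow> weakens \<rho> \<Delta> \<Delta>' \<Longrightarrow> el \<Delta> A t t'
    \<Longrightarrow> el \<Delta>' (ren \<rho> A) (ren \<rho> t) (ren \<rho> t')"
  using tyeq_ren_and_el_ren by blast+

lemma arg_ren:
  assumes "tyeq i \<Delta> A A'" "weakens \<rho> \<Delta> \<Delta>'" "arg r (el \<Delta> A) u u'"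
  shows "arg r (el \<Delta>' (ren \<rho> A)) (ren \<rho> u) (ren \<rho> u')"
  using assms by (cases r) (auto simp: arg_def intro: el_ren)

lemma tyeq_whe_eq:
  assumes "tyeq i \<Delta> A A'" "whe_eq B A"
  shows "tyeq i \<Delta> B A'"
proof -
  from assms(1) obtain R where "Ty i \<Delta> A A' R" by (auto simp: tyeq_iff_Ty)
  then show ?thesis
  proof cases
    case (sem_sort j)
    with assms(2) show ?thesis by (auto simp: whe_eq_eval intro: tyeq_sort)
  next
    case (sem_ne N N')
    with whe_eq_eval[OF assms(2)] show ?thesis by (blast intro: tyeq_ne)
  next
    case (sem_fun r s s' U T U' T' RU RT)
    have "eval B (Pi r s s' U T)" using whe_eq_eval[OF assms(2)] sem_fun(2) by blast
    from Ty_tyeq[OF semty.sem_fun[OF this sem_fun(3-5)]] show ?thesis .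
  qed
qed

text \<open>Elements are tested only by evaluation: at sorts and neutral types through their value,
  at function types through their applications, to which \<open>whe_eq\<close> extends. Validity of
  beta and eta rests on this closure.\<close>

lemma el_whe_eq: "tyeq i \<Delta> A A' \<Longrightarrow> el \<Delta> A t t' \<Longrightarrow> whe_eq s t \<Longrightarrow> el \<Delta> A s t'"
proof (induction arbitrary: s t t' rule: tyeq_induct)
  case (sort \<Delta> A A' j)
  then show ?case by (simp add: el_sort[OF sort(1)] tyeq_whe_eq)
next
  case (ne \<Delta> A A' N N')
  then show ?case unfolding el_ne[OF ne(1,3)] using whe_eq_eval[OF ne.prems(2)] by blast
next
  case (func \<Delta> A A' r s0 s' U T U' T')
  show ?case unfolding el_fun[OF func(1,2)]
  proof (intro allI impI)
    fix \<rho> \<Delta>' u u' assume w: "weakens \<rho> \<Delta> \<Delta>'" and a: "arg r (el \<Delta>' (ren \<rho> U)) u u'"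
    with func.prems(1) have "el \<Delta>' (inst u (ren (up_ren \<rho>) T)) (App r (ren \<rho> t) u) (App r (ren \<rho> t') u')"
      unfolding el_fun[OF func(1,2)] by blast
    from func(7)[OF w a this whe_eq_App[OF whe_eq_ren[OF func.prems(2)]]]
    show "el \<Delta>' (inst u (ren (up_ren \<rho>) T)) (App r (ren \<rho> s) u) (App r (ren \<rho> t') u')" .
  qed
qed

lemma el_whe_eq': "tyeq i \<Delta> A A' \<Longrightarrow> el \<Delta> A t t' \<Longrightarrow> whe_eq s t' \<Longrightarrow> el \<Delta> A t s"
  by (blast intro: el_sym el_whe_eq)


section \<open>Reflection and reification\<close>

lemma alg_TyQ: "alg (TyQ \<Delta> T T') = whe T \<then> (\<lambda>A. whe T' \<then> (\<lambda>A'. alg (TyW \<Delta> A A')))"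
  by (subst alg.simps) simp

lemma alg_TyW:
  "alg (TyW \<Delta> A A') = (if neutral A \<and> neutral A' then alg (NeQ \<Delta> A A') \<then> (\<lambda>_. Some (Ok None))
        else (case (A, A') of
            (Sort s, Sort s') \<Rightarrow> if s = s' then Some (Ok None) else Some Fail
          | (Pi r s1 s2 U T, Pi r' s1' s2' U' T') \<Rightarrow>
              if r = r' \<and> s1 = s1' \<and> s2 = s2'
              then alg (TyQ \<Delta> U U') \<then> (\<lambda>_. alg (TyQ ((r, U) # \<Delta>) T T'))
              else Some Fail
          | _ \<Rightarrow> Some Fail))"
  by (subst alg.simps) simp

lemma alg_NeQ_Var:
  "alg (NeQ \<Delta> (Var i) m) = (if m = Var i
     then (case relvar \<Delta> i of Some T \<Rightarrow> Some (Ok (Some T)) | None \<Rightarrow> Some Fail) else Some Fail)"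
  by (subst alg.simps) (auto split: tm.split)

lemma alg_NeQ_App:
  "alg (NeQ \<Delta> (App r n u) (App r m u')) = alg (NeW \<Delta> n m) \<then> (\<lambda>A.
     case A of
       Some (Pi r'' s s' U T) \<Rightarrow>
         if r'' = r then
           (case r of
               Rel \<Rightarrow> alg (TmQ \<Delta> u u' U) \<then> (\<lambda>_. Some (Ok (Some (inst u T))))
             | Irr \<Rightarrow> Some (Ok (Some (inst u T))))
         else Some Fail
     | _ \<Rightarrow> Some Fail)"
  by (subst alg.simps) simp

lemma alg_NeQ_App_fail:
  "\<nexists>m u'. n' = App r m u' \<Longrightarrow> alg (NeQ \<Delta> (App r n u) n') = Some Fail"
  by (subst alg.simps) (auto split: tm.split)

lemma alg_NeW:
  "alg (NeW \<Delta> n n') = alg (NeQ \<Delta> n n') \<then> (\<lambda>R.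
     case R of Some T \<Rightarrow> whe T \<then> (\<lambda>A. Some (Ok (Some A))) | None \<Rightarrow> Some Fail)"
  by (subst alg.simps) simp

lemma alg_TmQ: "alg (TmQ \<Delta> t t' T) = whe T \<then> (\<lambda>A. alg (TmW \<Delta> t t' A))"
  by (subst alg.simps) simp

lemma alg_TmW:
  "alg (TmW \<Delta> t t' (Sort s)) = alg (TyQ \<Delta> t t')"
  "alg (TmW \<Delta> t t' (Pi r s1 s2 U T)) =
    alg (TmQ ((r, U) # \<Delta>) (App r (ren Suc t) (Var 0)) (App r (ren Suc t') (Var 0)) T)"
  "neutral N \<Longrightarrow> alg (TmW \<Delta> t t' N) =
    whe t \<then> (\<lambda>n. whe t' \<then> (\<lambda>n'. alg (NeQ \<Delta> n n') \<then> (\<lambda>_. Some (Ok None))))"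
  by (subst alg.simps, simp)+

lemma terminates_alg: "terminates q \<longleftrightarrow> alg q \<noteq> None"
  by (simp add: terminates_def)

lemma andthen_halts:
  "\<exists>y. m = Some y \<Longrightarrow> (\<And>x. m = Some (Ok x) \<Longrightarrow> \<exists>y. k x = Some y) \<Longrightarrow> \<exists>y. (m \<then> k) = Some y"
  by (cases m) (auto simp: andthen_def split: result.splits)

lemma eval_whe: "eval t a \<Longrightarrow> whe t = Some (Ok a)"
  by (simp add: whe_iff_eval)

lemma wn_neutral_wne: "wn n \<Longrightarrow> neutral n \<Longrightarrow> wne n"
  by (erule wn_cases) (auto dest!: eval_whe simp: whe_neutral)

lemma wn_Pi: "wn (Pi r s s' U T) \<Longrightarrow> wn U \<and> wn T"
  by (erule wn_cases) (auto dest!: eval_whe simp: whe.simps[of "Pi _ _ _ _ _"])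

text \<open>The algorithm eta-expands the right-hand term at a function type whatever its value is.
  A sort, a function type or an abstraction with the other annotation makes the application fail,
  which \<open>wn\<close> accepts.\<close>

lemma wn_App_Var:
  assumes "wn t"
  shows "wn (App r (ren Suc t) (Var 0))"
proof -
  have x: "wn (Var 0)" by (rule wne_wn[OF wne_var])
  from wn_ren(1)[OF assms, of Suc] show ?thesis
  proof (cases rule: wn_cases)
    case (4 r' U b)
    \<comment> \<open>Instantiation with a variable is a renaming and so preserves normalization,
      which instantiation with an arbitrary term need not do.\<close>
    have "inst (Var 0) b = ren (case_nat 0 (\<lambda>i. i)) b" for b
    proof -
      have "case_nat (Var 0) Var = Var \<circ> case_nat 0 (\<lambda>i. i)"
        by (rule ext) (simp split: nat.split)
      then show ?thesis by (simp add: inst_eq sub_Var_comp)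
    qed
    then have b: "wn (inst (Var 0) b)" using wn_ren(1)[OF 4(2)] by simp
    have e: "whe (App r (ren Suc t) (Var 0)) = (if r' = r then whe (inst (Var 0) b) else Some Fail)"
      using eval_whe[OF 4(1)] by (simp add: whe_App)
    show ?thesis
    proof (cases "r' = r")
      case True
      with e have e: "whe_eq (App r (ren Suc t) (Var 0)) (inst (Var 0) b)" by (simp add: whe_eq_def)
      from b e show ?thesis by (rule wn_whe_eq)
    next
      case False
      with e show ?thesis by (simp add: wn_fail)
    qed
  next
    case (5 n)
    from ev_app[OF 5(1) ev_neutral[OF 5(3)]] show ?thesis
      by (rule wn_of_eval[rotated]) (intro wne_wn wne_app 5(2) x)
  qed (auto dest!: eval_whe simp: whe_App intro!: wn_fail)
qed

text \<open>The second hypothesis excludes failure: if \<open>t\<close> evaluated to a function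
  type, the application would fail and count as normalizing whatever the parts of that type. If
  \<open>t\<close> evaluates to an abstraction, the fresh variable gives back its body
  unchanged.\<close>

lemma wn_of_App_Var:
  assumes "wn (App r (ren Suc t) (Var 0))" "eval (App r (ren Suc t) (Var 0)) a"
  shows "wn t"
proof -
  from assms(2) have "whe (App r (ren Suc t) (Var 0)) = Some (Ok a)" by (rule eval_whe)
  then obtain f' where f': "whe (ren Suc t) = Some (Ok f')"
    and a: "(if neutral f' then Some (Ok (App r f' (Var 0)))
        else (case f' of
            Lam r' U b \<Rightarrow> if r' = r then whe (inst (Var 0) b) else Some Fail
          | _ \<Rightarrow> Some Fail)) = Some (Ok a)"
    by (auto simp: whe_App andthen_eq_Ok)
  then obtain f where f: "eval t f" "f' = ren Suc f" by (auto simp: whe_iff_eval eval_ren_iff)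
  have wa: "wn a" using wn_eval assms by blast
  show ?thesis
  proof (cases "neutral f")
    case True
    with a f have "a = App r (ren Suc f) (Var 0)" by simp
    with wa True have "wne (App r (ren Suc f) (Var 0))" by (simp add: wn_neutral_wne)
    then have "wne (ren Suc f)" by (rule wne_AppE)
    then have "wne f" using wn_unren(2) by blast
    with f show ?thesis using wn_ne by blast
  next
    case False
    with a f obtain U b where b: "f = Lam r U b" "whe b = Some (Ok a)"
      by (cases f) (auto split: if_splits)
    from wa have "wn b" using b(2) by (simp add: wn_of_eval whe_iff_eval)
    with b f show ?thesis using wn_lam by blast
  qed
qed

text \<open>Partial correctness of inference: a query that fails satisfies it. The output is
  computed from the context and \<open>A\<close> comes from semantic typing, so the two are compared
  in the model only.\<close>

definition infers :: "ctxt \<Rightarrow> tm \<Rightarrow> tm \<Rightarrow> bool" where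
  "infers \<Delta> A n \<longleftrightarrow> wne n \<and> (\<forall>\<rho> \<Delta>' m. weakens \<rho> \<Delta> \<Delta>' \<longrightarrow> whnf m \<longrightarrow> wn m
    \<longrightarrow> alg (NeQ \<Delta>' (ren \<rho> n) m) \<noteq> None
      \<and> (\<forall>T. alg (NeQ \<Delta>' (ren \<rho> n) m) = Some (Ok (Some T)) \<longrightarrow> (\<exists>k. tyeq k \<Delta>' T (ren \<rho> A))))"

lemma infers_safe: "infers \<Delta> A n \<Longrightarrow> safe \<Delta> n"
  by (auto simp: infers_def safe_def terminates_alg)

lemma infers_neutral: "infers \<Delta> A n \<Longrightarrow> neutral n"
  by (simp add: infers_def wne_neutral)

lemma infers_ren: "infers \<Delta> A n \<Longrightarrow> weakens \<rho> \<Delta> \<Delta>' \<Longrightarrow> infers \<Delta>' (ren \<rho> A) (ren \<rho> n)"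
  unfolding infers_def ren_ren using weakens_comp wn_ren(2) by blast

lemma infers_cong:
  assumes "infers \<Delta> A n" "tyeq i \<Delta> A A'"
  shows "infers \<Delta> A' n"
  using assms(1) tyeq_trans[OF _ tyeq_ren[OF assms(2)]] unfolding infers_def by blast

text \<open>An irrelevant variable infers any type, because the query on it fails.\<close>

lemma infers_Var_0:
  assumes "tyeq i \<Delta> U' U"
  shows "infers ((r, U') # \<Delta>) (ren Suc U) (Var 0)"
proof -
  have "alg (NeQ \<Delta>' (ren \<rho> (Var 0)) m) \<noteq> None
      \<and> (\<forall>T. alg (NeQ \<Delta>' (ren \<rho> (Var 0)) m) = Some (Ok (Some T))
        \<longrightarrow> (\<exists>k. tyeq k \<Delta>' T (ren \<rho> (ren Suc U))))"
    if w: "weakens \<rho> ((r, U') # \<Delta>) \<Delta>'" for \<rho> \<Delta>' m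
  proof -
    have "tyeq i \<Delta>' (ren \<rho> (ren Suc U')) (ren \<rho> (ren Suc U))"
      using tyeq_ren[OF tyeq_ren[OF assms weakens_Suc] w] .
    moreover have "relvar \<Delta>' (\<rho> 0) = (if r = Rel then Some (ren \<rho> (ren Suc U')) else None)"
      using w by (simp add: weakens_def relvar_0)
    ultimately show ?thesis by (auto simp: alg_NeQ_Var)
  qed
  then show ?thesis by (simp add: infers_def wne_var)
qed

lemma tyeq_fun_inv_id:
  assumes "tyeq i \<Delta> A A'" "eval A (Pi r s s' U T)"
  shows "\<exists>U' T'. eval A' (Pi r s s' U' T') \<and> tyeq i \<Delta> U U'
    \<and> (\<forall>u u'. arg r (el \<Delta> U) u u' \<longrightarrow> tyeq i \<Delta> (inst u T) (inst u' T'))"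
proof -
  from tyeq_fun_inv[OF assms] obtain U' T' where e: "eval A' (Pi r s s' U' T')"
    and U: "\<forall>\<rho> \<Delta>'. weakens \<rho> \<Delta> \<Delta>' \<longrightarrow> tyeq i \<Delta>' (ren \<rho> U) (ren \<rho> U')"
    and T: "\<forall>\<rho> \<Delta>' u u'. weakens \<rho> \<Delta> \<Delta>' \<longrightarrow> arg r (el \<Delta>' (ren \<rho> U)) u u'
        \<longrightarrow> tyeq i \<Delta>' (inst u (ren (up_ren \<rho>) T)) (inst u' (ren (up_ren \<rho>) T'))"
    by blast
  from e U[rule_format, OF weakens_id] T[rule_format, OF weakens_id] show ?thesis by auto
qed

text \<open>The type inferred for the head equals \<open>A\<close> semantically; inverting this
  equation exposes a function type with domain \<open>V\<close> and codomain \<open>W\<close> that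
  match \<open>U\<close> and \<open>T\<close>. The arguments are compared at \<open>V\<close>, which
  is why \<open>chk\<close> covers every type equal to \<open>U\<close>.\<close>

lemma infers_App:
  assumes n: "infers \<Delta> A n" and A: "tyeq i \<Delta> A A'" "eval A (Pi r s s' U T)"
    and u: "arg r (el \<Delta> U) u u" "wn u"
    and chk: "\<And>\<rho> \<Delta>' k V b. weakens \<rho> \<Delta> \<Delta>' \<Longrightarrow> tyeq k \<Delta>' V (ren \<rho> U) \<Longrightarrow> wn b
      \<Longrightarrow> terminates (TmQ \<Delta>' (ren \<rho> u) b V)"
  shows "infers \<Delta> (inst u T) (App r n u)"
proof -
  have "alg (NeQ \<Delta>' (ren \<rho> (App r n u)) m) \<noteq> None
      \<and> (\<forall>S. alg (NeQ \<Delta>' (ren \<rho> (App r n u)) m) = Some (Ok (Some S))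
        \<longrightarrow> (\<exists>k. tyeq k \<Delta>' S (ren \<rho> (inst u T))))"
    if w: "weakens \<rho> \<Delta> \<Delta>'" and m: "whnf m" "wn m" for \<rho> \<Delta>' m
  proof (cases "\<exists>m1 u1. m = App r m1 u1")
    case False
    then show ?thesis by (simp add: alg_NeQ_App_fail)
  next
    case True
    then obtain m1 u1 where m_eq: "m = App r m1 u1" by blast
    \<comment> \<open>An application in weak head normal form is neutral, so its hereditary
      normalization splits into that of head and argument.\<close>
    with m wn_neutral_wne have "wne (App r m1 u1)" by simp
    then have m1: "wne m1" and u1: "wn u1" by (rule wne_AppE; simp)+
    have m1': "whnf m1" "wn m1"
      using m1 by (simp_all add: neutral_whnf wne_neutral wne_wn)
    let ?q = "alg (NeQ \<Delta>' (ren \<rho> n) m1)"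
    have q: "?q \<noteq> None" "\<And>S. ?q = Some (Ok (Some S)) \<Longrightarrow> \<exists>k. tyeq k \<Delta>' S (ren \<rho> A)"
      using n w m1' unfolding infers_def by blast+
    show ?thesis
    proof (cases "\<exists>S. ?q = Some (Ok (Some S))")
      case False
      with q(1) have "alg (NeW \<Delta>' (ren \<rho> n) m1) = Some Fail"
        unfolding alg_NeW by (cases ?q) (auto simp: andthen_def split: result.split option.split)
      then show ?thesis by (simp add: m_eq alg_NeQ_App)
    next
      case True
      then obtain S k where S: "?q = Some (Ok (Some S))" "tyeq k \<Delta>' S (ren \<rho> A)" using q(2) by blast
      note e = eval_ren[OF A(2), of \<rho>, simplified]
      from tyeq_fun_inv_id[OF tyeq_sym[OF S(2)] e] obtain V W where
        V: "eval S (Pi r s s' V W)" "tyeq k \<Delta>' (ren \<rho> U) V"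
        and W: "\<forall>u u'. arg r (el \<Delta>' (ren \<rho> U)) u u'
          \<longrightarrow> tyeq k \<Delta>' (inst u (ren (up_ren \<rho>) T)) (inst u' W)"
        by blast
      from tyeq_fun_inv_id[OF A] obtain U' where "tyeq i \<Delta> U U'" by blast
      from arg_ren[OF this w u(1)] W
      have "tyeq k \<Delta>' (ren \<rho> (inst u T)) (inst (ren \<rho> u) W)" by (simp add: ren_inst)
      then have W: "tyeq k \<Delta>' (inst (ren \<rho> u) W) (ren \<rho> (inst u T))" by (rule tyeq_sym)
      have "alg (NeW \<Delta>' (ren \<rho> n) m1) = Some (Ok (Some (Pi r s s' V W)))"
        by (simp add: alg_NeW S(1) eval_whe[OF V(1)])
      moreover have "alg (TmQ \<Delta>' (ren \<rho> u) u1 V) \<noteq> None"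
        using chk[OF w tyeq_sym[OF V(2)] u1] by (simp add: terminates_alg)
      then obtain x where "alg (TmQ \<Delta>' (ren \<rho> u) u1 V) = Some x" by blast
      ultimately show ?thesis
        using W by (cases x) (auto simp: m_eq alg_NeQ_App split: ann.splits)
    qed
  qed
  with n u(2) show ?thesis by (simp add: infers_def wne_app)
qed


text \<open>Reification and reflection depend on each other at function types: the fresh variable
  must be an element of the domain by reflection, and reflecting an applied neutral term requires
  its argument to be reified. The type \<open>A'\<close> of the query may differ from
  \<open>A\<close>, because inferred types are known only up to \<open>tyeq\<close>. That an element
  has a value is recorded besides \<open>wn\<close>, which alone would admit failure.\<close>

definition reifiable :: "ctxt \<Rightarrow> tm \<Rightarrow> bool" where
  "reifiable \<Delta> A \<longleftrightarrow> wn A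
    \<and> (\<forall>B. wn B \<longrightarrow> terminates (TyQ \<Delta> A B))
    \<and> (\<forall>t t'. el \<Delta> A t t' \<longrightarrow> wn t \<and> (\<exists>a. eval t a))
    \<and> (\<forall>t t' k A' b. el \<Delta> A t t' \<longrightarrow> tyeq k \<Delta> A' A \<longrightarrow> wn b \<longrightarrow> terminates (TmQ \<Delta> t b A'))
    \<and> (\<forall>n n'. infers \<Delta> A n \<longrightarrow> infers \<Delta> A n' \<longrightarrow> el \<Delta> A n n')"

lemma reifiableD:
  assumes "reifiable \<Delta> A"
  shows "wn A"
    and "wn B \<Longrightarrow> terminates (TyQ \<Delta> A B)"
    and "el \<Delta> A t t' \<Longrightarrow> wn t \<and> (\<exists>a. eval t a)"
    and "el \<Delta> A t t' \<Longrightarrow> tyeq k \<Delta> A' A \<Longrightarrow> wn b \<Longrightarrow> terminates (TmQ \<Delta> t b A')"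
    and "infers \<Delta> A n \<Longrightarrow> infers \<Delta> A n' \<Longrightarrow> el \<Delta> A n n'"
  using assms unfolding reifiable_def by blast+

lemma terminates_NeQ_safe:
  assumes "safe \<Delta> n" "whnf m" "wn m"
  shows "alg (NeQ \<Delta> n m) \<noteq> None"
  using assms(1)[unfolded safe_def, THEN conjunct2, rule_format, OF weakens_id assms(2,3)]
  by (simp add: terminates_alg)

lemma tyeq_halts:
  assumes "tyeq i \<Delta> A A'"
  shows "\<exists>a. eval A a"
  using Ty_el[OF assms] by cases blast+

text \<open>A comparison at a sort becomes a comparison of types of a lower level, which
  \<open>IH\<close> covers; reflection holds because any two safe neutral types are related.\<close>

lemma reifiable_sort:
  assumes A: "eval A (Sort (Set j))" and IH: "\<And>B B'. tyeq j \<Delta> B B' \<Longrightarrow> reifiable \<Delta> B"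
  shows "reifiable \<Delta> A"
proof -
  have "terminates (TyQ \<Delta> A B)" if B: "wn B" for B
    unfolding terminates_def alg_TyQ
    by (rule andthen_halts)
      (use eval_whe[OF A] wn_halts[OF B] in \<open>auto intro!: andthen_halts simp: alg_TyW split: tm.split\<close>)
  moreover have "terminates (TmQ \<Delta> t b A')"
    if "el \<Delta> A t t'" "tyeq k \<Delta> A' A" "wn b" for t t' k A' b
  proof -
    have "eval A' (Sort (Set j))" using tyeq_sort_inv[OF tyeq_sym[OF that(2)] A] by blast
    moreover have "terminates (TyQ \<Delta> t b)"
      using that(1,3) IH unfolding el_sort[OF A] by (blast dest: reifiableD(2))
    ultimately show ?thesis by (simp add: terminates_alg alg_TmQ eval_whe alg_TmW)
  qed
  moreover have "tyeq j \<Delta> n n'" if "infers \<Delta> A n" "infers \<Delta> A n'" for n n'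
    using tyeq_ne[OF eval_neutral eval_neutral] that infers_safe infers_neutral by blast
  ultimately show ?thesis
    unfolding reifiable_def el_sort[OF A] using wn_sort[OF A] IH reifiableD(1) tyeq_halts by blast
qed

lemma reifiable_ne:
  assumes A: "eval A N" "safe \<Delta> N"
  shows "reifiable \<Delta> A"
proof -
  have "terminates (TyQ \<Delta> A B)" if B: "wn B" for B
  proof -
    have "alg (TyW \<Delta> N B') \<noteq> None" if "whe B = Some (Ok B')" for B'
    proof (cases "neutral B'")
      case True
      with that have "whnf B'" "wn B'"
        using eval_whnf(1) wn_eval[OF B] by (auto simp: whe_iff_eval)
      from terminates_NeQ_safe[OF A(2) this] True safe_neutral[OF A(2)] show ?thesis
        by (auto simp: alg_TyW intro!: andthen_halts)
    next
      case False
      with safe_neutral[OF A(2)] show ?thesis by (cases N) (auto simp: alg_TyW split: tm.split)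
    qed
    with eval_whe[OF A(1)] wn_halts[OF B] show ?thesis
      unfolding terminates_def alg_TyQ by (auto intro!: andthen_halts)
  qed
  moreover have "terminates (TmQ \<Delta> t b A')"
    if t: "el \<Delta> A t t'" and A': "tyeq k \<Delta> A' A" and b: "wn b" for t t' k A' b
  proof -
    from tyeq_ne_inv[OF tyeq_sym[OF A'] A] obtain N' where N': "eval A' N'" "safe \<Delta> N'" by blast
    from t obtain n where n: "eval t n" "safe \<Delta> n" unfolding el_ne[OF A] by blast
    have "alg (NeQ \<Delta> n m) \<noteq> None" if "whe b = Some (Ok m)" for m
      using terminates_NeQ_safe[OF n(2)] that eval_whnf(1) wn_eval[OF b] by (auto simp: whe_iff_eval)
    with wn_halts[OF b] show ?thesis
      unfolding terminates_def
      by (auto simp: alg_TmQ eval_whe[OF N'(1)] alg_TmW(3)[OF safe_neutral[OF N'(2)]] eval_whe[OF n(1)]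
          intro!: andthen_halts)
  qed
  moreover have "el \<Delta> A n n'" if "infers \<Delta> A n" "infers \<Delta> A n'" for n n'
    unfolding el_ne[OF A] using that infers_safe eval_neutral infers_neutral by blast
  moreover have "wn t \<and> (\<exists>a. eval t a)" if "el \<Delta> A t t'" for t t'
    using that wn_ne unfolding el_ne[OF A] safe_def by blast
  moreover have "wn A" using A by (auto simp: safe_def intro: wn_of_eval wne_wn)
  ultimately show ?thesis unfolding reifiable_def by blast
qed

lemma reifiable_fun:
  assumes A: "tyeq i \<Delta> A A'" "eval A (Pi r s s' U T)"
    and U: "\<And>\<rho> \<Delta>'. weakens \<rho> \<Delta> \<Delta>' \<Longrightarrow> reifiable \<Delta>' (ren \<rho> U)"
    and T: "\<And>\<rho> \<Delta>' u. weakens \<rho> \<Delta> \<Delta>' \<Longrightarrow> arg r (el \<Delta>' (ren \<rho> U)) u u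
        \<Longrightarrow> reifiable \<Delta>' (inst u (ren (up_ren \<rho>) T))"
  shows "reifiable \<Delta> A"
proof -
  have U_refl: "tyeq i \<Delta>' (ren \<rho> U) (ren \<rho> U)" if "weakens \<rho> \<Delta> \<Delta>'" for \<rho> \<Delta>'
    using tyeq_fun_inv[OF A] that tyeq_left by blast
  have U0: "reifiable \<Delta> U" using U[OF weakens_id] by simp
  \<comment> \<open>The algorithm extends the context by the domain \<open>V\<close> of the type it
    was called with, which equals \<open>U\<close> only semantically.\<close>
  have var: "arg r (el ((r, V) # \<Delta>) (ren Suc U)) (Var 0) (Var 0)" if "tyeq k \<Delta> V U" for k V
    using reifiableD(5)[OF U[OF weakens_Suc] infers_Var_0 infers_Var_0, OF that that]
    by (cases r) (simp_all add: arg_def)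
  have T_var: "reifiable ((r, V) # \<Delta>) T" if "tyeq k \<Delta> V U" for k V
    using T[OF weakens_Suc var[OF that]] by simp
  have U_id: "tyeq i \<Delta> U U" using U_refl[OF weakens_id] by simp
  have "wn A"
    using wn_pi[OF A(2) reifiableD(1)[OF U0] reifiableD(1)[OF T_var[OF U_id]]] .
  moreover have "terminates (TyQ \<Delta> A B)" if B: "wn B" for B
  proof -
    have "alg (TyW \<Delta> (Pi r s s' U T) B') \<noteq> None" if e: "whe B = Some (Ok B')" for B'
    proof (cases "\<exists>U' T'. B' = Pi r s s' U' T'")
      case True
      then obtain U' T' where B': "B' = Pi r s s' U' T'" by blast
      with wn_eval[OF B] e have "wn U'" "wn T'" by (auto simp: whe_iff_eval dest: wn_Pi)
      with reifiableD(2)[OF U0] reifiableD(2)[OF T_var[OF U_id]] show ?thesis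
        by (auto simp: B' alg_TyW terminates_alg intro!: andthen_halts)
    next
      case False
      then show ?thesis by (auto simp: alg_TyW split: tm.split)
    qed
    with eval_whe[OF A(2)] wn_halts[OF B] show ?thesis
      unfolding terminates_def alg_TyQ by (auto intro!: andthen_halts)
  qed
  moreover have app: "el ((r, V) # \<Delta>) T (App r (ren Suc t) (Var 0)) (App r (ren Suc t') (Var 0))"
    if "tyeq k \<Delta> V U" "el \<Delta> A t t'" for k V t t'
    using that(2)[unfolded el_fun[OF A]] weakens_Suc[of \<Delta> r V] var[OF that(1)] inst_Var_0[of T] by metis
  moreover have "wn t \<and> (\<exists>a. eval t a)" if t: "el \<Delta> A t t'" for t t'
  proof -
    from reifiableD(3)[OF T_var[OF U_id] app[OF U_id t]] obtain a
      where a: "wn (App r (ren Suc t) (Var 0))" "eval (App r (ren Suc t) (Var 0)) a" by blast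
    from a(2) have "whe (App r (ren Suc t) (Var 0)) = Some (Ok a)" by (rule eval_whe)
    then obtain f where "whe (ren Suc t) = Some (Ok f)" by (auto simp: whe_App andthen_eq_Ok)
    then have "\<exists>f. eval t f" by (auto simp: whe_iff_eval eval_ren_iff)
    with wn_of_App_Var[OF a] show ?thesis by blast
  qed
  moreover have "terminates (TmQ \<Delta> t b B)"
    if t: "el \<Delta> A t t'" and B: "tyeq k \<Delta> B A" and b: "wn b" for t t' k B b
  proof -
    from tyeq_fun_inv[OF tyeq_sym[OF B] A(2)] obtain V W where e: "eval B (Pi r s s' V W)"
      and V: "\<forall>\<rho> \<Delta>'. weakens \<rho> \<Delta> \<Delta>' \<longrightarrow> tyeq k \<Delta>' (ren \<rho> U) (ren \<rho> V)"
      and W: "\<forall>\<rho> \<Delta>' u u'. weakens \<rho> \<Delta> \<Delta>' \<longrightarrow> arg r (el \<Delta>' (ren \<rho> U)) u u'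
        \<longrightarrow> tyeq k \<Delta>' (inst u (ren (up_ren \<rho>) T)) (inst u' (ren (up_ren \<rho>) W))"
      by blast
    have V: "tyeq k \<Delta> V U" using V[rule_format, OF weakens_id] by (simp add: tyeq_sym)
    \<comment> \<open>At the fresh variable the codomain clause becomes an equation between the open
      codomains, under the context the algorithm uses.\<close>
    have "tyeq k ((r, V) # \<Delta>) W T"
      using W[rule_format, OF weakens_Suc var[OF V]] by (simp add: tyeq_sym)
    from reifiableD(4)[OF T_var[OF V] app[OF V t] this wn_App_Var[OF b]] show ?thesis
      by (simp add: terminates_alg alg_TmQ eval_whe[OF e] alg_TmW)
  qed
  moreover have "el \<Delta> A n n'" if n: "infers \<Delta> A n" "infers \<Delta> A n'" for n n'
    unfolding el_fun[OF A]
  proof (intro allI impI)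
    fix \<rho> \<Delta>' u u' assume w: "weakens \<rho> \<Delta> \<Delta>'" and a: "arg r (el \<Delta>' (ren \<rho> U)) u u'"
    note per = el_symp[OF U_refl[OF w]] el_transp[OF U_refl[OF w]]
    note e = eval_ren[OF A(2), of \<rho>, simplified]
    have app: "infers \<Delta>' (inst v (ren (up_ren \<rho>) T)) (App r (ren \<rho> m) v)"
      if m: "infers \<Delta> A m" and v: "arg r (el \<Delta>' (ren \<rho> U)) v v" for m v
    proof (rule infers_App[OF infers_ren[OF m w] tyeq_ren[OF A(1) w] e v])
      have v': "el \<Delta>' (ren \<rho> U) v v" using v by (cases r) (simp_all add: arg_def)
      then show "wn v" using reifiableD(3)[OF U[OF w]] by blast
      fix \<rho>' \<Delta>'' k V b
      assume w': "weakens \<rho>' \<Delta>' \<Delta>''" and V: "tyeq k \<Delta>'' V (ren \<rho>' (ren \<rho> U))" and b: "wn b"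
      from U[OF weakens_comp[OF w w']] have "reifiable \<Delta>'' (ren \<rho>' (ren \<rho> U))"
        by (simp add: ren_ren)
      then show "terminates (TmQ \<Delta>'' (ren \<rho>' v) b V)"
        by (rule reifiableD(4)[OF _ el_ren[OF U_refl[OF w] w' v'] V b])
    qed
    \<comment> \<open>The two applications infer \<open>T\<close> at \<open>u\<close> and
      \<open>T\<close> at \<open>u'\<close>. Both equal the partner \<open>T'\<close> at
      \<open>u'\<close>, so reflection can take place at a single type.\<close>
    have TT: "tyeq i \<Delta>' (inst u' (ren (up_ren \<rho>) T)) (inst u (ren (up_ren \<rho>) T))"
    proof -
      from tyeq_fun_inv[OF A] obtain T' where
        "\<forall>v v'. arg r (el \<Delta>' (ren \<rho> U)) v v'
          \<longrightarrow> tyeq i \<Delta>' (inst v (ren (up_ren \<rho>) T)) (inst v' (ren (up_ren \<rho>) T'))"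
        using w by blast
      with a arg_right[OF per a] show ?thesis by (blast intro: tyeq_sym tyeq_trans)
    qed
    from reifiableD(5)[OF T[OF w arg_left[OF per a]] app[OF n(1) arg_left[OF per a]]
        infers_cong[OF app[OF n(2) arg_right[OF per a]] TT]]
    show "el \<Delta>' (inst u (ren (up_ren \<rho>) T)) (App r (ren \<rho> n) u) (App r (ren \<rho> n') u')" .
  qed
  ultimately show ?thesis unfolding reifiable_def by blast
qed

lemma tyeq_reifiable: "tyeq i \<Delta> A A' \<Longrightarrow> reifiable \<Delta> A"
proof (induction i arbitrary: \<Delta> A A' rule: less_induct)
  case (less i)
  from less.prems show ?case
  proof (induction rule: tyeq_induct)
    case (sort \<Delta> A A' j)
    from sort(1) less.IH[OF sort(3)] show ?case by (rule reifiable_sort)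
  next
    case (ne \<Delta> A A' N N')
    from ne(1,3) show ?case by (rule reifiable_ne)
  next
    case (func \<Delta> A A' r s s' U T U' T')
    from func(1,2,6,7) show ?case by (rule reifiable_fun)
  qed
qed


section \<open>Soundness of the model\<close>

text \<open>Each entry stores its type equation: \<open>el\<close> is taken at the left instance of
  the type, and symmetry and transitivity have to move to the other one.\<close>

primrec sim :: "ctxt \<Rightarrow> ctxt \<Rightarrow> (nat \<Rightarrow> tm) \<Rightarrow> (nat \<Rightarrow> tm) \<Rightarrow> bool" where
  "sim [] \<Delta> \<sigma> \<sigma>' \<longleftrightarrow> True"
| "sim (d # \<Gamma>) \<Delta> \<sigma> \<sigma>' \<longleftrightarrow> sim \<Gamma> \<Delta> (\<sigma> \<circ> Suc) (\<sigma>' \<circ> Suc)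
    \<and> (\<exists>i. tyeq i \<Delta> (sub (\<sigma> \<circ> Suc) (snd d)) (sub (\<sigma>' \<circ> Suc) (snd d)))
    \<and> arg (fst d) (el \<Delta> (sub (\<sigma> \<circ> Suc) (snd d))) (\<sigma> 0) (\<sigma>' 0)"

lemma arg_trans: "transp R \<Longrightarrow> arg r R u u' \<Longrightarrow> arg r R u' u'' \<Longrightarrow> arg r R u u''"
  by (cases r) (auto simp: arg_def dest: transpD)

lemma sim_sym: "sim \<Gamma> \<Delta> \<sigma> \<sigma>' \<Longrightarrow> sim \<Gamma> \<Delta> \<sigma>' \<sigma>"
proof (induction \<Gamma> arbitrary: \<sigma> \<sigma>')
  case (Cons d \<Gamma>)
  from Cons.prems obtain i where i: "tyeq i \<Delta> (sub (\<sigma> \<circ> Suc) (snd d)) (sub (\<sigma>' \<circ> Suc) (snd d))" by auto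
  with Cons arg_sym[OF el_symp[OF i]] el_cong[OF i] tyeq_sym[OF i] show ?case by auto
qed simp

lemma sim_trans: "sim \<Gamma> \<Delta> \<sigma> \<sigma>' \<Longrightarrow> sim \<Gamma> \<Delta> \<sigma>' \<sigma>'' \<Longrightarrow> sim \<Gamma> \<Delta> \<sigma> \<sigma>''"
proof (induction \<Gamma> arbitrary: \<sigma> \<sigma>' \<sigma>'')
  case (Cons d \<Gamma>)
  from Cons.prems(1) obtain i where i: "tyeq i \<Delta> (sub (\<sigma> \<circ> Suc) (snd d)) (sub (\<sigma>' \<circ> Suc) (snd d))" by auto
  from Cons.prems(2) obtain k where k: "tyeq k \<Delta> (sub (\<sigma>' \<circ> Suc) (snd d)) (sub (\<sigma>'' \<circ> Suc) (snd d))" by auto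
  have "sim \<Gamma> \<Delta> (\<sigma> \<circ> Suc) (\<sigma>'' \<circ> Suc)" using Cons by auto
  moreover have "arg (fst d) (el \<Delta> (sub (\<sigma> \<circ> Suc) (snd d))) (\<sigma> 0) (\<sigma>'' 0)"
    using Cons.prems el_cong[OF i] arg_trans[OF el_transp[OF i]] by auto
  ultimately show ?case using tyeq_trans[OF i k] by auto
qed simp

lemma sim_left: "sim \<Gamma> \<Delta> \<sigma> \<sigma>' \<Longrightarrow> sim \<Gamma> \<Delta> \<sigma> \<sigma>"
  using sim_sym sim_trans by blast

lemma sim_right: "sim \<Gamma> \<Delta> \<sigma> \<sigma>' \<Longrightarrow> sim \<Gamma> \<Delta> \<sigma>' \<sigma>'"
  using sim_sym sim_trans by blast

lemma sim_ren:
  "sim \<Gamma> \<Delta> \<sigma> \<sigma>' \<Longrightarrow> weakens \<rho> \<Delta> \<Delta>' \<Longrightarrow> sim \<Gamma> \<Delta>' (ren \<rho> \<circ> \<sigma>) (ren \<rho> \<circ> \<sigma>')"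
proof (induction \<Gamma> arbitrary: \<sigma> \<sigma>')
  case (Cons d \<Gamma>)
  from Cons.prems obtain i where i: "tyeq i \<Delta> (sub (\<sigma> \<circ> Suc) (snd d)) (sub (\<sigma>' \<circ> Suc) (snd d))" by auto
  have "sim \<Gamma> \<Delta> (\<sigma> \<circ> Suc) (\<sigma>' \<circ> Suc)" using Cons.prems(1) by simp
  note Cons.IH[OF this Cons.prems(2)]
  moreover have "arg (fst d) (el \<Delta> (sub (\<sigma> \<circ> Suc) (snd d))) (\<sigma> 0) (\<sigma>' 0)" using Cons.prems by simp
  note arg_ren[OF i Cons.prems(2) this]
  ultimately show ?case
    using tyeq_ren[OF i Cons.prems(2)] by (auto simp: comp_def ren_sub)
qed simp

text \<open>Confined to the diagonal: at an irrelevant declaration the two entries are related only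
  to themselves, so distinct substitutions need not stay related once the declaration becomes
  relevant.\<close>

lemma sim_resurrect: "sim \<Gamma> \<Delta> \<sigma> \<sigma> \<Longrightarrow> sim (resurrect \<Gamma>) \<Delta> \<sigma> \<sigma>"
proof (induction \<Gamma> arbitrary: \<sigma>)
  case (Cons d \<Gamma>)
  then show ?case
    by (cases d; cases "fst d") (auto simp: resurrect_def arg_def)
qed (simp add: resurrect_def)

lemma case_nat_comp_Suc [simp]: "case_nat u \<sigma> \<circ> Suc = \<sigma>"
  by (rule ext) simp

lemma sim_Cons:
  "sim \<Gamma> \<Delta> \<sigma> \<sigma>' \<Longrightarrow> tyeq i \<Delta> (sub \<sigma> U) (sub \<sigma>' U) \<Longrightarrow> arg r (el \<Delta> (sub \<sigma> U)) u u'
    \<Longrightarrow> sim ((r, U) # \<Gamma>) \<Delta> (case_nat u \<sigma>) (case_nat u' \<sigma>')"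
  by auto

section \<open>Semantic validity of the judgements\<close>

definition valid_ty :: "ctxt \<Rightarrow> tm \<Rightarrow> bool" where
  "valid_ty \<Gamma> T \<longleftrightarrow> (\<forall>\<Delta> \<sigma> \<sigma>'. sim \<Gamma> \<Delta> \<sigma> \<sigma>' \<longrightarrow> (\<exists>i. tyeq i \<Delta> (sub \<sigma> T) (sub \<sigma>' T)))"

definition valid :: "ctxt \<Rightarrow> tm \<Rightarrow> tm \<Rightarrow> tm \<Rightarrow> bool" where
  "valid \<Gamma> t t' T \<longleftrightarrow> valid_ty \<Gamma> T
    \<and> (\<forall>\<Delta> \<sigma> \<sigma>'. sim \<Gamma> \<Delta> \<sigma> \<sigma>' \<longrightarrow> el \<Delta> (sub \<sigma> T) (sub \<sigma> t) (sub \<sigma>' t'))"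

primrec valid_ctx :: "ctxt \<Rightarrow> bool" where
  "valid_ctx [] \<longleftrightarrow> True"
| "valid_ctx (d # \<Gamma>) \<longleftrightarrow> valid_ctx \<Gamma> \<and> valid_ty \<Gamma> (snd d)"

lemma valid_tyD: "valid_ty \<Gamma> T \<Longrightarrow> sim \<Gamma> \<Delta> \<sigma> \<sigma>' \<Longrightarrow> \<exists>i. tyeq i \<Delta> (sub \<sigma> T) (sub \<sigma>' T)"
  by (simp add: valid_ty_def)

lemma validD:
  assumes "valid \<Gamma> t t' T"
  shows "valid_ty \<Gamma> T" and "sim \<Gamma> \<Delta> \<sigma> \<sigma>' \<Longrightarrow> el \<Delta> (sub \<sigma> T) (sub \<sigma> t) (sub \<sigma>' t')"
  using assms by (simp_all add: valid_def)

lemma eval_Sort: "eval (Sort s) (Sort s)"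
  by (simp add: ev_whnf)

lemma eval_Pi: "eval (Pi r s s' U T) (Pi r s s' U T)"
  by (simp add: ev_whnf)

lemma valid_ty_Sort: "valid_ty \<Gamma> (Sort (Set j))"
  using tyeq_sort[OF eval_Sort eval_Sort lessI] by (auto simp: valid_ty_def)

lemma valid_Sort:
  "valid \<Gamma> A A' (Sort (Set j)) \<longleftrightarrow>
    (\<forall>\<Delta> \<sigma> \<sigma>'. sim \<Gamma> \<Delta> \<sigma> \<sigma>' \<longrightarrow> tyeq j \<Delta> (sub \<sigma> A) (sub \<sigma>' A'))"
  by (simp add: valid_def valid_ty_Sort el_sort[OF eval_Sort])

lemma valid_el_cong:
  "valid_ty \<Gamma> T \<Longrightarrow> sim \<Gamma> \<Delta> \<sigma> \<sigma>' \<Longrightarrow> el \<Delta> (sub \<sigma> T) = el \<Delta> (sub \<sigma>' T)"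
  using valid_tyD el_cong by blast

lemma valid_sym:
  assumes "valid \<Gamma> t t' T"
  shows "valid \<Gamma> t' t T"
  unfolding valid_def
proof (intro conjI allI impI)
  fix \<Delta> \<sigma> \<sigma>' assume s: "sim \<Gamma> \<Delta> \<sigma> \<sigma>'"
  from valid_tyD[OF validD(1)[OF assms] s] obtain i where i: "tyeq i \<Delta> (sub \<sigma> T) (sub \<sigma>' T)" ..
  from validD(2)[OF assms sim_sym[OF s]]
  show "el \<Delta> (sub \<sigma> T) (sub \<sigma> t') (sub \<sigma>' t)"
    unfolding el_cong[OF i] by (rule el_sym[OF tyeq_sym[OF i]])
qed (rule validD(1)[OF assms])

lemma valid_trans:
  assumes "valid \<Gamma> t t' T" "valid \<Gamma> t' t'' T"
  shows "valid \<Gamma> t t'' T"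
  unfolding valid_def
proof (intro conjI allI impI)
  fix \<Delta> \<sigma> \<sigma>' assume s: "sim \<Gamma> \<Delta> \<sigma> \<sigma>'"
  from valid_tyD[OF validD(1)[OF assms(1)] s] obtain i where i: "tyeq i \<Delta> (sub \<sigma> T) (sub \<sigma>' T)" ..
  from validD(2)[OF assms(1) sim_left[OF s]] validD(2)[OF assms(2) s]
  show "el \<Delta> (sub \<sigma> T) (sub \<sigma> t) (sub \<sigma>' t'')" by (rule el_trans[OF i])
qed (rule validD(1)[OF assms(1)])

lemma valid_left: "valid \<Gamma> t t' T \<Longrightarrow> valid \<Gamma> t t T"
  using valid_sym valid_trans by blast

lemma valid_imp_valid_ty:
  assumes "valid \<Gamma> T T' (Sort s)"
  shows "valid_ty \<Gamma> T"
proof -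
  obtain j where "s = Set j" by (cases s)
  with valid_left[OF assms] have "valid \<Gamma> T T (Sort (Set j))" by simp
  then show ?thesis unfolding valid_ty_def valid_Sort by blast
qed

lemma valid_conv:
  assumes t: "valid \<Gamma> t t' T" and T: "valid \<Gamma> T T' (Sort s)"
  shows "valid \<Gamma> t t' T'"
  unfolding valid_def
proof (intro conjI allI impI)
  show "valid_ty \<Gamma> T'" using valid_imp_valid_ty[OF valid_sym[OF T]] .
  fix \<Delta> \<sigma> \<sigma>' assume s: "sim \<Gamma> \<Delta> \<sigma> \<sigma>'"
  obtain j where "s = Set j" by (cases s)
  with T have "valid \<Gamma> T T' (Sort (Set j))" by simp
  from this[unfolded valid_Sort] sim_left[OF s] have "tyeq j \<Delta> (sub \<sigma> T) (sub \<sigma> T')" by blast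
  from validD(2)[OF t s, unfolded el_cong[OF this]]
  show "el \<Delta> (sub \<sigma> T') (sub \<sigma> t) (sub \<sigma>' t')" .
qed

lemma valid_Var:
  assumes "relvar \<Gamma> i = Some U"
  shows "valid \<Gamma> (Var i) (Var i) U"
proof -
  have "(\<exists>k. tyeq k \<Delta> (sub \<sigma> U) (sub \<sigma>' U)) \<and> el \<Delta> (sub \<sigma> U) (\<sigma> i) (\<sigma>' i)"
    if "sim \<Gamma> \<Delta> \<sigma> \<sigma>'" for \<Delta> \<sigma> \<sigma>'
    using that assms
  proof (induction \<Gamma> arbitrary: i U \<sigma> \<sigma>')
    case Nil
    then show ?case by (simp add: relvar_def)
  next
    case (Cons d \<Gamma>)
    obtain r T where d: "d = (r, T)" by (cases d)
    show ?case
    proof (cases i)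
      case 0
      with Cons.prems d show ?thesis
        by (auto simp: relvar_0 sub_ren arg_def split: if_splits)
    next
      case (Suc k)
      with Cons.prems(2) d obtain V where V: "relvar \<Gamma> k = Some V" "U = ren Suc V"
        by (auto simp: relvar_Suc)
      from Cons.prems(1) have "sim \<Gamma> \<Delta> (\<sigma> \<circ> Suc) (\<sigma>' \<circ> Suc)" by simp
      from Cons.IH[OF this V(1)] V(2) Suc show ?thesis by (simp add: sub_ren comp_def)
    qed
  qed
  then show ?thesis unfolding valid_def valid_ty_def by auto
qed

lemma valid_Pi:
  assumes U: "valid \<Gamma> U U' (Sort (Set i))" and T: "valid ((r, U) # \<Gamma>) T T' (Sort (Set j))"
  shows "valid \<Gamma> (Pi r s s' U T) (Pi r s s' U' T') (Sort (Set (max i j)))"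
  unfolding valid_Sort
proof (intro allI impI)
  fix \<Delta> \<sigma> \<sigma>' assume sim: "sim \<Gamma> \<Delta> \<sigma> \<sigma>'"
  show "tyeq (max i j) \<Delta> (sub \<sigma> (Pi r s s' U T)) (sub \<sigma>' (Pi r s s' U' T'))"
    unfolding sub.simps
  proof (rule tyeq_fun[OF eval_Pi eval_Pi])
    fix \<rho> \<Delta>' assume "weakens \<rho> \<Delta> \<Delta>'"
    note sim = sim_ren[OF sim this]
    from U[unfolded valid_Sort] sim have "tyeq i \<Delta>' (sub (ren \<rho> \<circ> \<sigma>) U) (sub (ren \<rho> \<circ> \<sigma>') U')"
      by blast
    then show "tyeq (max i j) \<Delta>' (ren \<rho> (sub \<sigma> U)) (ren \<rho> (sub \<sigma>' U'))"
      by (simp add: ren_sub tyeq_mono)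
    fix u u' assume "arg r (el \<Delta>' (ren \<rho> (sub \<sigma> U))) u u'"
    then have a: "arg r (el \<Delta>' (sub (ren \<rho> \<circ> \<sigma>) U)) u u'" by (simp add: ren_sub)
    \<comment> \<open>Extending \<open>sim\<close> takes two instances of the same declared type,
      hence \<open>U\<close> against itself instead of \<open>U\<close> against
      \<open>U'\<close>.\<close>
    from valid_left[OF U, unfolded valid_Sort] sim
    have "tyeq i \<Delta>' (sub (ren \<rho> \<circ> \<sigma>) U) (sub (ren \<rho> \<circ> \<sigma>') U)" by blast
    from sim_Cons[OF sim this a] T[unfolded valid_Sort]
    have "tyeq j \<Delta>' (sub (case_nat u (ren \<rho> \<circ> \<sigma>)) T) (sub (case_nat u' (ren \<rho> \<circ> \<sigma>')) T')" by blast
    then show "tyeq (max i j) \<Delta>' (inst u (ren (up_ren \<rho>) (sub (up_sub \<sigma>) T)))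
        (inst u' (ren (up_ren \<rho>) (sub (up_sub \<sigma>') T')))"
      by (simp add: inst_ren_sub tyeq_mono)
  qed
qed

lemma tyeq_PiD:
  assumes "tyeq i \<Delta> (Pi r s s' U T) (Pi r s s' U' T')"
  shows "tyeq i \<Delta> U U'" and "arg r (el \<Delta> U) u u' \<Longrightarrow> tyeq i \<Delta> (inst u T) (inst u' T')"
  using tyeq_fun_inv_id[OF assms eval_Pi] by (blast dest: eval_det[OF eval_Pi])+

lemma valid_ty_Pi_dom:
  assumes "valid_ty \<Gamma> (Pi r s s' U T)"
  shows "valid_ty \<Gamma> U"
  unfolding valid_ty_def
proof (intro allI impI)
  fix \<Delta> \<sigma> \<sigma>' assume "sim \<Gamma> \<Delta> \<sigma> \<sigma>'"
  from valid_tyD[OF assms this] obtain i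
    where "tyeq i \<Delta> (Pi r s s' (sub \<sigma> U) (sub (up_sub \<sigma>) T)) (Pi r s s' (sub \<sigma>' U) (sub (up_sub \<sigma>') T))"
    by auto
  from tyeq_PiD(1)[OF this] show "\<exists>i. tyeq i \<Delta> (sub \<sigma> U) (sub \<sigma>' U)" by blast
qed

lemma valid_el_Pi:
  assumes "valid_ty \<Gamma> (Pi r s s' U T)" "sim \<Gamma> \<Delta> \<sigma> \<sigma>'"
  shows "el \<Delta> (sub \<sigma> (Pi r s s' U T)) f f' \<longleftrightarrow> (\<forall>\<rho> \<Delta>' u u'. weakens \<rho> \<Delta> \<Delta>'
    \<longrightarrow> arg r (el \<Delta>' (sub (ren \<rho> \<circ> \<sigma>) U)) u u'
    \<longrightarrow> el \<Delta>' (sub (case_nat u (ren \<rho> \<circ> \<sigma>)) T) (App r (ren \<rho> f) u) (App r (ren \<rho> f') u'))"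
proof -
  from valid_tyD[OF assms] obtain i
    where "tyeq i \<Delta> (Pi r s s' (sub \<sigma> U) (sub (up_sub \<sigma>) T)) (Pi r s s' (sub \<sigma>' U) (sub (up_sub \<sigma>') T))"
    by auto
  from el_fun[OF this eval_Pi] show ?thesis by (simp add: ren_sub[of _ _ U] inst_ren_sub)
qed

text \<open>Applied to related arguments, the abstractions evaluate like their instantiated bodies,
  and closure under \<open>whe_eq\<close> on both sides carries the relation back. The beta step
  erases the domain annotations, so \<open>U'\<close> is arbitrary.\<close>

lemma valid_Lam:
  assumes Pi: "valid_ty \<Gamma> (Pi r s s' U T)" and t: "valid ((r, U) # \<Gamma>) t t' T"
  shows "valid \<Gamma> (Lam r U t) (Lam r U' t') (Pi r s s' U T)"
  unfolding valid_def
proof (intro conjI allI impI Pi)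
  fix \<Delta> \<sigma> \<sigma>' assume sim: "sim \<Gamma> \<Delta> \<sigma> \<sigma>'"
  show "el \<Delta> (sub \<sigma> (Pi r s s' U T)) (sub \<sigma> (Lam r U t)) (sub \<sigma>' (Lam r U' t'))"
    unfolding valid_el_Pi[OF Pi sim]
  proof (intro allI impI)
    fix \<rho> \<Delta>' u u'
    assume w: "weakens \<rho> \<Delta> \<Delta>'" and a: "arg r (el \<Delta>' (sub (ren \<rho> \<circ> \<sigma>) U)) u u'"
    note sim = sim_ren[OF sim w]
    from valid_tyD[OF valid_ty_Pi_dom[OF Pi] sim] obtain i
      where "tyeq i \<Delta>' (sub (ren \<rho> \<circ> \<sigma>) U) (sub (ren \<rho> \<circ> \<sigma>') U)" ..
    note sim = sim_Cons[OF sim this a]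
    from valid_tyD[OF validD(1)[OF t] sim] obtain k
      where k: "tyeq k \<Delta>' (sub (case_nat u (ren \<rho> \<circ> \<sigma>)) T) (sub (case_nat u' (ren \<rho> \<circ> \<sigma>')) T)" ..
    have beta: "whe_eq (App r (ren \<rho> (sub \<tau> (Lam r V b))) v) (sub (case_nat v (ren \<rho> \<circ> \<tau>)) b)" for \<tau> V b v
      using whe_eq_beta by (simp add: inst_ren_sub[symmetric])
    from el_whe_eq'[OF k el_whe_eq[OF k validD(2)[OF t sim] beta] beta]
    show "el \<Delta>' (sub (case_nat u (ren \<rho> \<circ> \<sigma>)) T)
        (App r (ren \<rho> (sub \<sigma> (Lam r U t))) u) (App r (ren \<rho> (sub \<sigma>' (Lam r U' t'))) u')" .
  qed
qed

definition valid_arg :: "ann \<Rightarrow> ctxt \<Rightarrow> tm \<Rightarrow> tm \<Rightarrow> tm \<Rightarrow> bool" where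
  "valid_arg r \<Gamma> u u' U \<longleftrightarrow> (\<forall>\<Delta> \<sigma> \<sigma>'. sim \<Gamma> \<Delta> \<sigma> \<sigma>'
    \<longrightarrow> arg r (el \<Delta> (sub \<sigma> U)) (sub \<sigma> u) (sub \<sigma>' u'))"

lemma valid_arg_Rel: "valid \<Gamma> u u' U \<Longrightarrow> valid_arg Rel \<Gamma> u u' U"
  by (simp add: valid_arg_def valid_def arg_def)

text \<open>Resurrection keeps only the diagonal, but \<open>arg Irr\<close> asks for no more: each
  argument is self-related under its own substitution. Validity of \<open>U\<close> moves the second
  claim from \<open>\<sigma>'\<close> to \<open>\<sigma>\<close>.\<close>

lemma valid_arg_Irr:
  assumes "valid_ty \<Gamma> U" "valid (resurrect \<Gamma>) u u U" "valid (resurrect \<Gamma>) u' u' U"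
  shows "valid_arg Irr \<Gamma> u u' U"
proof -
  have "el \<Delta> (sub \<sigma> U) (sub \<sigma> u) (sub \<sigma> u) \<and> el \<Delta> (sub \<sigma> U) (sub \<sigma>' u') (sub \<sigma>' u')"
    if "sim \<Gamma> \<Delta> \<sigma> \<sigma>'" for \<Delta> \<sigma> \<sigma>'
    using validD(2)[OF assms(2) sim_resurrect[OF sim_left[OF that]]]
      validD(2)[OF assms(3) sim_resurrect[OF sim_right[OF that]]] valid_el_cong[OF assms(1) that]
    by simp
  then show ?thesis by (simp add: valid_arg_def arg_def)
qed

lemma valid_arg_argctx:
  "valid_ty \<Gamma> U \<Longrightarrow> valid (argctx r \<Gamma>) u u U \<Longrightarrow> valid_arg r \<Gamma> u u U"
  by (cases r) (auto simp: argctx_def intro: valid_arg_Rel valid_arg_Irr)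

lemma valid_arg_left:
  assumes U: "valid_ty \<Gamma> U" and u: "valid_arg r \<Gamma> u u' U"
  shows "valid_arg r \<Gamma> u u U"
  unfolding valid_arg_def
proof (intro allI impI)
  fix \<Delta> \<sigma> \<sigma>' assume sim: "sim \<Gamma> \<Delta> \<sigma> \<sigma>'"
  from valid_tyD[OF U sim] obtain i where i: "tyeq i \<Delta> (sub \<sigma> U) (sub \<sigma>' U)" ..
  have "arg r (el \<Delta> (sub \<sigma> U)) (sub \<sigma> u) (sub \<sigma>' u')"
    using u sim by (simp add: valid_arg_def)
  moreover have "arg r (el \<Delta> (sub \<sigma> U)) (sub \<sigma>' u') (sub \<sigma>' u)"
    using u sim_right[OF sim] arg_sym[OF el_symp[OF i]] by (simp add: valid_arg_def el_cong[OF i])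
  ultimately show "arg r (el \<Delta> (sub \<sigma> U)) (sub \<sigma> u) (sub \<sigma>' u)"
    by (rule arg_trans[OF el_transp[OF i]])
qed

lemma valid_ty_inst:
  assumes "valid_ty \<Gamma> (Pi r s s' U T)" "valid_arg r \<Gamma> u u U"
  shows "valid_ty \<Gamma> (inst u T)"
  unfolding valid_ty_def
proof (intro allI impI)
  fix \<Delta> \<sigma> \<sigma>' assume sim: "sim \<Gamma> \<Delta> \<sigma> \<sigma>'"
  from valid_tyD[OF assms(1) sim] obtain i
    where "tyeq i \<Delta> (Pi r s s' (sub \<sigma> U) (sub (up_sub \<sigma>) T)) (Pi r s s' (sub \<sigma>' U) (sub (up_sub \<sigma>') T))"
    by auto
  from tyeq_PiD(2)[OF this assms(2)[unfolded valid_arg_def, rule_format, OF sim]]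
  show "\<exists>i. tyeq i \<Delta> (sub \<sigma> (inst u T)) (sub \<sigma>' (inst u T))"
    unfolding sub_inst inst_sub by blast
qed

lemma valid_App:
  assumes t: "valid \<Gamma> t t' (Pi r s s' U T)" and u: "valid_arg r \<Gamma> u u' U"
  shows "valid \<Gamma> (App r t u) (App r t' u') (inst u T)"
  unfolding valid_def
proof (intro conjI allI impI)
  note Pi = validD(1)[OF t]
  show "valid_ty \<Gamma> (inst u T)"
    by (rule valid_ty_inst[OF Pi valid_arg_left[OF valid_ty_Pi_dom[OF Pi] u]])
  fix \<Delta> \<sigma> \<sigma>' assume sim: "sim \<Gamma> \<Delta> \<sigma> \<sigma>'"
  have ren_id': "ren (\<lambda>i. i) \<circ> \<sigma> = \<sigma>" by (rule ext) simp
  from u sim have "arg r (el \<Delta> (sub \<sigma> U)) (sub \<sigma> u) (sub \<sigma>' u')" by (simp add: valid_arg_def)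
  with validD(2)[OF t sim, unfolded valid_el_Pi[OF Pi sim], rule_format, OF weakens_id]
  show "el \<Delta> (sub \<sigma> (inst u T)) (sub \<sigma> (App r t u)) (sub \<sigma>' (App r t' u'))"
    by (simp add: sub_inst ren_id')
qed

lemma valid_beta:
  assumes U: "valid_ty \<Gamma> U" and t: "valid ((r, U) # \<Gamma>) t t T" and u: "valid_arg r \<Gamma> u u U"
  shows "valid \<Gamma> (App r (Lam r U t) u) (inst u t) (inst u T)"
proof -
  have "(\<exists>i. tyeq i \<Delta> (sub \<sigma> (inst u T)) (sub \<sigma>' (inst u T)))
    \<and> el \<Delta> (sub \<sigma> (inst u T)) (sub \<sigma> (App r (Lam r U t) u)) (sub \<sigma>' (inst u t))"
    if sim: "sim \<Gamma> \<Delta> \<sigma> \<sigma>'" for \<Delta> \<sigma> \<sigma>'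
  proof -
    from valid_tyD[OF U sim] obtain i where i: "tyeq i \<Delta> (sub \<sigma> U) (sub \<sigma>' U)" ..
    from u sim have "arg r (el \<Delta> (sub \<sigma> U)) (sub \<sigma> u) (sub \<sigma>' u)" by (simp add: valid_arg_def)
    note sim = sim_Cons[OF sim i this]
    from valid_tyD[OF validD(1)[OF t] sim] obtain k
      where k: "tyeq k \<Delta> (sub \<sigma> (inst u T)) (sub \<sigma>' (inst u T))" unfolding sub_inst ..
    from validD(2)[OF t sim] have "el \<Delta> (sub \<sigma> (inst u T)) (sub \<sigma> (inst u t)) (sub \<sigma>' (inst u t))"
      unfolding sub_inst .
    moreover have "whe_eq (sub \<sigma> (App r (Lam r U t) u)) (sub \<sigma> (inst u t))"
      using whe_eq_beta by (simp add: sub_inst inst_sub[symmetric])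
    ultimately show ?thesis using k el_whe_eq by blast
  qed
  then show ?thesis unfolding valid_def valid_ty_def by blast
qed

lemma valid_eta:
  assumes t: "valid \<Gamma> t t (Pi r s s' U T)"
  shows "valid \<Gamma> t (Lam r U (App r (ren Suc t) (Var 0))) (Pi r s s' U T)"
  unfolding valid_def
proof (intro conjI allI impI)
  show Pi: "valid_ty \<Gamma> (Pi r s s' U T)" by (rule validD(1)[OF t])
  fix \<Delta> \<sigma> \<sigma>' assume sim: "sim \<Gamma> \<Delta> \<sigma> \<sigma>'"
  show "el \<Delta> (sub \<sigma> (Pi r s s' U T)) (sub \<sigma> t) (sub \<sigma>' (Lam r U (App r (ren Suc t) (Var 0))))"
    unfolding valid_el_Pi[OF Pi sim]
  proof (intro allI impI)
    fix \<rho> \<Delta>' u u'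
    assume w: "weakens \<rho> \<Delta> \<Delta>'" and a: "arg r (el \<Delta>' (sub (ren \<rho> \<circ> \<sigma>) U)) u u'"
    from validD(2)[OF t sim] w a
    have el: "el \<Delta>' (sub (case_nat u (ren \<rho> \<circ> \<sigma>)) T) (App r (ren \<rho> (sub \<sigma> t)) u) (App r (ren \<rho> (sub \<sigma>' t)) u')"
      unfolding valid_el_Pi[OF Pi sim] by blast
    \<comment> \<open>Closure under \<open>whe_eq\<close> asks for some type equation with the
      codomain instance on its left; inverting the function type provides one.\<close>
    from valid_tyD[OF Pi sim] obtain i
      where "tyeq i \<Delta> (Pi r s s' (sub \<sigma> U) (sub (up_sub \<sigma>) T)) (Pi r s s' (sub \<sigma>' U) (sub (up_sub \<sigma>') T))"
      by auto
    from tyeq_fun_inv[OF this eval_Pi] obtain T' where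
      "\<forall>\<rho> \<Delta>' u u'. weakens \<rho> \<Delta> \<Delta>' \<longrightarrow> arg r (el \<Delta>' (ren \<rho> (sub \<sigma> U))) u u'
        \<longrightarrow> tyeq i \<Delta>' (inst u (ren (up_ren \<rho>) (sub (up_sub \<sigma>) T))) (inst u' (ren (up_ren \<rho>) T'))"
      by blast
    with w a have i: "tyeq i \<Delta>' (sub (case_nat u (ren \<rho> \<circ> \<sigma>)) T) (inst u' (ren (up_ren \<rho>) T'))"
      unfolding ren_sub[of _ _ U] inst_ren_sub by blast
    have "whe_eq (App r (ren \<rho> (sub \<sigma>' (Lam r U (App r (ren Suc t) (Var 0))))) u')
        (inst u' (ren (up_ren \<rho>) (sub (up_sub \<sigma>') (App r (ren Suc t) (Var 0)))))"
      using whe_eq_beta by simp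
    also have "inst u' (ren (up_ren \<rho>) (sub (up_sub \<sigma>') (App r (ren Suc t) (Var 0))))
        = App r (ren \<rho> (sub \<sigma>' t)) u'"
      unfolding inst_ren_sub by (simp add: sub_ren ren_sub)
    finally show "el \<Delta>' (sub (case_nat u (ren \<rho> \<circ> \<sigma>)) T) (App r (ren \<rho> (sub \<sigma> t)) u)
        (App r (ren \<rho> (sub \<sigma>' (Lam r U (App r (ren Suc t) (Var 0))))) u')"
      by (rule el_whe_eq'[OF i el])
  qed
qed

text \<open>Validity of the context belongs to the claim because \<open>eq_beta\<close> mentions the
  domain \<open>U\<close> only as a declaration or as the type of the argument: its validity over
  the unextended context is read off from \<open>valid_ctx\<close>.\<close>

theorem fundamental:
  "ctx \<Gamma> \<Longrightarrow> valid_ctx \<Gamma>"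
  "\<Gamma> \<turnstile> t \<^bold>: T \<Longrightarrow> valid_ctx \<Gamma> \<and> valid \<Gamma> t t T"
  "\<Gamma> \<turnstile> t \<^bold>= t' \<^bold>: T \<Longrightarrow> valid_ctx \<Gamma> \<and> valid \<Gamma> t t' T"
proof (induction rule: ctx_typing_equal.inducts)
  case ctx_nil
  then show ?case by simp
next
  case (ctx_cons \<Gamma> T s r)
  then show ?case by (auto intro: valid_imp_valid_ty)
next
  case (ty_sort \<Gamma> s s')
  then show ?case
    by (auto simp: Axiom_def valid_Sort intro: tyeq_sort[OF eval_Sort eval_Sort lessI])
next
  case (ty_pi \<Gamma> U s1 r T s2 s3)
  then show ?case by (auto simp: Rule_def intro: valid_Pi)
next
  case (ty_var \<Gamma> i U)
  then show ?case by (simp add: valid_Var)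
next
  case (ty_lam r U \<Gamma> t T s s' s'')
  then show ?case by (auto intro: valid_Lam valid_imp_valid_ty)
next
  case (ty_app \<Gamma> t r s s' U T u)
  then show ?case by (blast intro: valid_App valid_arg_argctx valid_ty_Pi_dom validD(1))
next
  case (ty_conv \<Gamma> t T T' s)
  then show ?case by (blast intro: valid_conv)
next
  case (eq_beta r U \<Gamma> t T u)
  then show ?case by (auto intro: valid_beta valid_arg_argctx)
next
  case (eq_eta \<Gamma> t r s s' U T)
  then show ?case by (blast intro: valid_eta)
next
  case (eq_refl \<Gamma> t T)
  then show ?case by blast
next
  case (eq_sym \<Gamma> t t' T)
  then show ?case by (blast intro: valid_sym)
next
  case (eq_trans \<Gamma> t1 t2 T t3)
  then show ?case by (blast intro: valid_trans)
next
  case (eq_pi \<Gamma> U U' s1 r T T' s2 s3)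
  then show ?case by (auto simp: Rule_def intro: valid_Pi)
next
  case (eq_lam \<Gamma> U U' s1 r T s2 t t')
  obtain i j where s: "s1 = Set i" "s2 = Set j" by (cases s1; cases s2)
  \<comment> \<open>The left side of this equation certifies the function type of the abstractions,
    for which \<open>eq_lam\<close> has no single premise.\<close>
  with eq_lam have "valid \<Gamma> (Pi r s1 s2 U T) (Pi r s1 s2 U' T) (Sort (Set (max i j)))"
    by (blast intro: valid_Pi)
  with eq_lam show ?case by (blast intro: valid_Lam valid_imp_valid_ty)
next
  case (eq_app_rel \<Gamma> t t' s s' U T u u')
  then show ?case by (blast intro: valid_App valid_arg_Rel)
next
  case (eq_app_irr \<Gamma> t t' s s' U T u u')
  then show ?case by (blast intro: valid_App valid_arg_Irr valid_ty_Pi_dom validD(1))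
next
  case (eq_conv \<Gamma> t t' T T' s)
  then show ?case by (blast intro: valid_conv)
qed

text \<open>Reflection makes every variable an element of its declared type, irrelevant ones
  included, so validity can be specialised to the terms themselves.\<close>

lemma sim_Var: "valid_ctx \<Gamma> \<Longrightarrow> sim \<Gamma> \<Gamma> Var Var"
proof (induction \<Gamma>)
  case (Cons d \<Gamma>)
  obtain r T where d: "d = (r, T)" by (cases d)
  have Suc: "ren Suc \<circ> Var = Var \<circ> Suc" by (rule ext) simp
  from Cons have sim: "sim \<Gamma> \<Gamma> Var Var" by simp
  from Cons.prems valid_tyD[OF _ sim, of T] d obtain i where i: "tyeq i \<Gamma> T T" by auto
  from tyeq_reifiable[OF tyeq_ren[OF i weakens_Suc[of \<Gamma> r T]]] infers_Var_0[OF i]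
  have "el ((r, T) # \<Gamma>) (ren Suc T) (Var 0) (Var 0)" by (blast intro: reifiableD(5))
  then have "arg r (el ((r, T) # \<Gamma>) (ren Suc T)) (Var 0) (Var 0)"
    by (cases r) (simp_all add: arg_def)
  moreover have "sim \<Gamma> ((r, T) # \<Gamma>) (Var \<circ> Suc) (Var \<circ> Suc)"
    using sim_ren[OF sim weakens_Suc[of \<Gamma> r T]] by (simp add: Suc)
  ultimately show ?case
    using tyeq_ren[OF i weakens_Suc[of \<Gamma> r T]] by (auto simp: d sub_Var_comp)
qed simp

theorem theorem6p6:
  fixes \<Delta> :: ctxt and t t' T :: tm
  assumes "\<Delta> \<turnstile> t \<^bold>: T" and "\<Delta> \<turnstile> t' \<^bold>: T"
  shows "terminates (TmQ \<Delta> t t' T)"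
proof -
  have "valid_ctx \<Delta>" using fundamental(2)[OF assms(1)] by blast
  then have sim: "sim \<Delta> \<Delta> Var Var" by (rule sim_Var)
  have valid: "valid \<Delta> t t T" "valid \<Delta> t' t' T"
    using fundamental(2)[OF assms(1)] fundamental(2)[OF assms(2)] by blast+
  from valid_tyD[OF validD(1)[OF valid(1)] sim] obtain i where i: "tyeq i \<Delta> T T" by auto
  have el: "el \<Delta> T t t" "el \<Delta> T t' t'"
    using validD(2)[OF valid(1) sim] validD(2)[OF valid(2) sim] by simp_all
  note reif = tyeq_reifiable[OF i]
  \<comment> \<open>The typing of \<open>t'\<close> enters the conclusion through this property
    alone.\<close>
  have "wn t'" using reifiableD(3)[OF reif el(2)] by blast
  then show ?thesis by (rule reifiableD(4)[OF reif el(1) i])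
qed

end
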